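(* Let $d>1$ be an integer, let $\mu_1\neq\mu_2\in\mathbb{R}^d$ and let $\Sigma_1,\Sigma_2$ be (symmetric) positive definite real $d\times d$ matrices. Let $v=\mu_1-\mu_2$ and let $\Pi$ be a $d\times(d-1)$ real matrix whose columns form a basis for the subspace of $\mathbb{R}^d$ orthogonal to $v$. Let $\rho_1,\dots,\rho_{d-1}$ denote the eigenvalues (with multiplicity) of $(\Pi^{\mathsf T}\Sigma_1\Pi)^{-1}\Pi^{\mathsf T}\Sigma_2\Pi-I_{d-1}$. Define $$tv(\mu_1,\Sigma_1,\mu_2,\Sigma_2)=\max\left\{\frac{|v^{\mathsf T}(\Sigma_1-\Sigma_2)v|}{v^{\mathsf T}\Sigma_1 v},\ \frac{v^{\mathsf T}v}{\sqrt{v^{\mathsf T}\Sigma_1 v}},\ \sqrt{\sum_{i=1}^{d-1}\rho_i^2}\right\}.$$ Then $$\frac{\min\{1,tv(\mu_1,\Sigma_1,\mu_2,\Sigma_2)\}}{200}\leq \operatorname{TV}\left(\mathcal{N}(\mu_1,\Sigma_1),\mathcal{N}(\mu_2,\Sigma_2)\right).$$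
   Context: For probability distributions $P,Q$ on $\mathbb{R}^d$, the total variation distance is $\operatorname{TV}(P,Q)=\sup_{A}|P(A)-Q(A)|$, the supremum being over (Borel) sets $A\subseteq\mathbb{R}^d$. For $\Sigma$ positive definite, $\mathcal{N}(\mu,\Sigma)$ is the Gaussian distribution on $\mathbb{R}^d$ with mean $\mu$ and covariance $\Sigma$, i.e. with density $\det(2\pi\Sigma)^{-1/2}\exp(-(x-\mu)^{\mathsf T}\Sigma^{-1}(x-\mu)/2)$. $I_k$ is the $k\times k$ identity matrix. *)

theory Defs
  imports "HOL-Probability.Probability" "HOL-Computational_Algebra.Computational_Algebra"
begin

definition pos_def_matrix :: "real ^ 'n ^ 'n \<Rightarrow> bool" where
  "pos_def_matrix A \<longleftrightarrow> transpose A = A \<and> (\<forall>x. x \<noteq> 0 \<longrightarrow> 0 < x \<bullet> (A *v x))"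

(* Intended for positive definite S; otherwise the density need not have total mass 1. *)
definition gaussian_density :: "real ^ 'n \<Rightarrow> real ^ 'n ^ 'n \<Rightarrow> real ^ 'n \<Rightarrow> real" where
  "gaussian_density m S x =
     det ((2 * pi) *\<^sub>R S) powr (- 1 / 2) * exp (- ((x - m) \<bullet> (matrix_inv S *v (x - m))) / 2)"

definition gaussian :: "real ^ 'n \<Rightarrow> real ^ 'n ^ 'n \<Rightarrow> (real ^ 'n) measure" where
  "gaussian m S = density lborel (\<lambda>x. ennreal (gaussian_density m S x))"

(* For probability measures the set below lies in [0, 1], so the real supremum is the true one. *)
definition TV :: "'a::topological_space measure \<Rightarrow> 'a measure \<Rightarrow> real" where
  "TV P Q = (SUP A\<in>sets borel. \<bar>measure P A - measure Q A\<bar>)"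

(* The j-th column is part of an indexed family, so distinctness of the columns belongs to
   linear independence; columns B on its own is only a set. *)
definition columns_basis_of :: "real ^ 'm ^ 'n \<Rightarrow> (real ^ 'n) set \<Rightarrow> bool" where
  "columns_basis_of B V \<longleftrightarrow>
     inj (\<lambda>j. column j B) \<and> independent (columns B) \<and> span (columns B) = V"

(* det (X I - A), computed over the polynomial ring *)
definition charpoly :: "real ^ 'm ^ 'm \<Rightarrow> real poly" where
  "charpoly A = det (\<chi> i j. (if i = j then [:0, 1:] else 0) - [:A $ i $ j:])"

(* The family r lists all eigenvalues of A, each as often as its algebraic multiplicity.
   Such a real r exists exactly when all complex eigenvalues of A are real, as is the case
   for A = (matrix_inv C ** D) - mat 1 with C positive definite and D symmetric, because
   matrix_inv C ** D is then similar to a symmetric matrix. *)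
definition eigenvalue_family :: "real ^ 'm ^ 'm \<Rightarrow> ('m \<Rightarrow> real) \<Rightarrow> bool" where
  "eigenvalue_family A r \<longleftrightarrow> charpoly A = (\<Prod>i\<in>UNIV. [:- r i, 1:])"

definition tv ::
  "real ^ 'n \<Rightarrow> real ^ 'n ^ 'n \<Rightarrow> real ^ 'n \<Rightarrow> real ^ 'n ^ 'n \<Rightarrow> ('m::finite \<Rightarrow> real) \<Rightarrow> real" where
  "tv m1 S1 m2 S2 r =
     (let v = m1 - m2 in
      Max {\<bar>v \<bullet> ((S1 - S2) *v v)\<bar> / (v \<bullet> (S1 *v v)),
           (v \<bullet> v) / sqrt (v \<bullet> (S1 *v v)),
           sqrt (\<Sum>i\<in>UNIV. (r i)\<^sup>2)})"

end

theory Submission imports Defs begin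

text \<open>Let \<open>\<Sigma>1 = T T\<^sup>t\<close> and \<open>\<Sigma>2 = T diag(l) T\<^sup>t\<close> with \<open>T\<close> invertible, and put
  \<open>w = T\<^sup>-\<^sup>1 (\<mu>1 - \<mu>2)\<close>. In the coordinates in which the second Gaussian is standard, the
  log-likelihood ratio is, up to sign, \<open>h = X + c\<close> with \<open>X\<close> a sum of independent centred terms
  \<open>a i * ((y i)\<^sup>2 - 1) + b i * y i\<close>, and twice the total variation distance is
  \<open>E \<bar>1 - exp (- h)\<bar>\<close>, which is at least \<open>E (\<bar>h\<bar> / (1 + \<bar>h\<bar>))\<close>. The fourth moment of
  \<open>h\<close> is at most \<open>30\<close> times the square of its second moment, so this expectation is bounded
  below in terms of the variance \<open>\<Sum>i. (l i - 1)\<^sup>2 / 2 + l i * (w i)\<^sup>2\<close> of \<open>X\<close>. Finally each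
  of the three quantities in \<open>tv\<close> is at most \<open>sqrt (\<Sum>i. (l i - 1)\<^sup>2)\<close> or \<open>norm w\<close>; for the
  third one this is the fact that compression to a subspace does not increase the Frobenius norm of
  \<open>diag(l) - I\<close>.\<close>

text \<open>Relative to the second Gaussian the first one has density \<open>exp (- h)\<close>,
  whose exponential moments can be huge or hard to control. The function
  \<open>\<bar>h\<bar> / (1 + \<bar>h\<bar>)\<close> is bounded and can be minorised by a quartic in
  \<open>h\<close>, so only polynomial moments enter. The constant \<open>c\<close> contains
  log-determinants; it is never estimated, because a shift of a centred variable only adds
  \<open>c\<^sup>2\<close> to the second moment and keeps the fourth moment comparable. The variance
  weights \<open>(w i)\<^sup>2\<close> by \<open>l i\<close>, which may be tiny. This is where the
  truncation \<open>min 1\<close> helps: if some \<open>l i\<close> is below 1/2, then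
  \<open>(l i - 1)\<^sup>2 / 2\<close> alone exceeds 1/8, and otherwise the weight costs at most a
  factor 2. Either way the variance is at least 1/8 of the square of the truncated
  \<open>tv\<close>. The constant 200 is 2 * 20 * 5: the 2 relates total variation to the L1
  distance, the 20 comes from the quartic minorant, and 5 is a generous bound for
  \<open>sqrt 8\<close>.\<close>

no_notation fps_nth (infixl "$" 75)

section \<open>Diagonalization of symmetric matrices\<close>

definition diagm :: "('n \<Rightarrow> real) \<Rightarrow> real ^ 'n ^ 'n" where
  "diagm l = (\<chi> i j. if i = j then l i else 0)"

lemma diagm_nth [simp]: "diagm l $ i $ j = (if i = j then l i else 0)"
  by (simp add: diagm_def)

lemma transpose_diagm [simp]: "transpose (diagm l) = diagm l"
  by (auto simp: transpose_def vec_eq_iff)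

lemma diagm_mult: "diagm l ** diagm k = diagm (\<lambda>i. l i * k i)"
  by (auto simp: matrix_matrix_mult_def vec_eq_iff if_distrib[where f="\<lambda>x. _ * x"]
      if_distrib[where f="\<lambda>x. x * _"] cong: if_cong)

lemma diagm_1 [simp]: "diagm (\<lambda>i. 1) = mat 1"
  by (simp add: vec_eq_iff mat_def)

lemma diagm_mult_vec: "diagm l *v x = (\<chi> i. l i * x $ i)"
  by (simp add: matrix_vector_mult_def vec_eq_iff if_distrib[where f="\<lambda>x. x * _"] cong: if_cong)

lemma det_diagm: "det (diagm l) = (\<Prod>i\<in>UNIV. l i)"
  by (subst det_diagonal) auto

lemma inner_transpose_mult: "x \<bullet> (transpose A *v y) = (A *v x) \<bullet> y"
  for A :: "real ^ 'n ^ 'm"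
  by (metis dot_lmul_matrix inner_commute transpose_matrix_vector)

text \<open>A maximiser of the quadratic form on the unit sphere of \<open>S\<close> is an
  eigenvector: by the first-order condition, \<open>A *v b\<close> has no component in
  \<open>S\<close> orthogonal to \<open>b\<close>. Working on an invariant subspace lets the next
  induction descend to orthogonal complements.\<close>

lemma symmetric_eigenvector_on_subspace:
  fixes A :: "real ^ 'n ^ 'n"
  assumes sym: "transpose A = A" and S: "subspace S" and inv: "\<And>x. x \<in> S \<Longrightarrow> A *v x \<in> S"
    and ne: "S \<noteq> {0}"
  obtains b c where "b \<in> S" "norm b = 1" "A *v b = c *\<^sub>R b"
proof -
  let ?q = "\<lambda>x. x \<bullet> (A *v x)"
  have symi: "x \<bullet> (A *v y) = (A *v x) \<bullet> y" for x y
    using inner_transpose_mult[of x A y] sym by simp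
  have cpt: "compact (S \<inter> sphere 0 1)"
    using closed_subspace[OF S] by (intro closed_Int_compact) auto
  obtain x where x: "x \<in> S" "x \<noteq> 0" using ne subspace_0[OF S] by blast
  then have "(1 / norm x) *\<^sub>R x \<in> S \<inter> sphere 0 1"
    using S by (auto intro: subspace_scale)
  then have ne': "S \<inter> sphere 0 1 \<noteq> {}" by blast
  have "continuous_on (S \<inter> sphere 0 1) ?q"
    by (intro continuous_intros matrix_vector_mult_linear_continuous_on)
  from continuous_attains_sup[OF cpt ne' this] obtain b where
    b: "b \<in> S" "norm b = 1" and mx: "\<And>y. y \<in> S \<Longrightarrow> norm y = 1 \<Longrightarrow> ?q y \<le> ?q b"
    by auto
  have qle: "?q y \<le> ?q b * (y \<bullet> y)" if "y \<in> S" for y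
  proof (cases "y = 0")
    case False
    have "?q ((1 / norm y) *\<^sub>R y) \<le> ?q b"
      using that False S by (intro mx) (auto intro: subspace_scale)
    then have "?q y / (norm y)\<^sup>2 \<le> ?q b"
      by (simp add: matrix_vector_mult_scaleR power2_eq_square)
    then show ?thesis using False by (simp add: divide_simps power2_norm_eq_inner mult.commute)
  qed auto
  have orth: "y \<bullet> (A *v b) = 0" if y: "y \<in> S" "y \<bullet> b = 0" for y
  proof -
    define a where "a = y \<bullet> (A *v b)"
    define c where "c = ?q b * (y \<bullet> y) - ?q y"
    \<comment> \<open>Maximality along the line \<open>b + t *\<^sub>R y\<close>: a nonzero linear
      term in \<open>t\<close> would beat the quadratic one for small \<open>t\<close>.\<close>
    have ineq: "2 * t * a \<le> t\<^sup>2 * c" for t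
    proof -
      have "b + t *\<^sub>R y \<in> S" using b y S by (auto intro: subspace_add subspace_scale)
      from qle[OF this] have "?q b + t * (b \<bullet> (A *v y)) + t * a + t\<^sup>2 * ?q y
          \<le> ?q b * (b \<bullet> b + t\<^sup>2 * (y \<bullet> y))"
        using y by (simp add: matrix_vector_right_distrib matrix_vector_mult_scaleR algebra_simps
            inner_commute[of b y] a_def power2_eq_square)
      moreover have "b \<bullet> (A *v y) = a" unfolding a_def symi[of b y] by (rule inner_commute)
      moreover have "b \<bullet> b = 1" using b by (simp add: norm_eq_1)
      ultimately show ?thesis unfolding c_def by (simp add: algebra_simps)
    qed
    have c0: "0 \<le> c" using ineq[of 1] ineq[of "-1"] by simp
    \<comment> \<open>A \<open>t\<close> small enough for the linear term to dominate; the
      \<open>+ 1\<close> keeps the denominator positive when \<open>c = 0\<close>.\<close>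
    have "2 * (a / (c + 1)) * a \<le> (a / (c+1))\<^sup>2 * c" by (rule ineq)
    then have "2 * a\<^sup>2 * (c+1) \<le> a\<^sup>2 * c" using c0
      by (simp add: power_divide divide_simps power2_eq_square mult_ac split: if_splits)
    then have "a\<^sup>2 * (c + 2) \<le> 0" by (simp add: algebra_simps)
    then show ?thesis using c0 by (simp add: mult_le_0_iff a_def)
  qed
  \<comment> \<open>The part of \<open>A *v b\<close> orthogonal to \<open>b\<close>. It lies in
    \<open>S\<close>, so \<open>orth\<close> applies to it and makes it orthogonal to
    itself.\<close>
  define y where "y = A *v b - ?q b *\<^sub>R b"
  have "y \<in> S" unfolding y_def using b inv S by (auto intro: subspace_diff subspace_scale)
  moreover have yb: "y \<bullet> b = 0" unfolding y_def using b
    by (simp add: inner_diff_left inner_diff_right norm_eq_1 inner_commute)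
  ultimately have "y \<bullet> (A *v b) = 0" by (rule orth)
  then have "y \<bullet> y = 0" using yb unfolding y_def by (simp add: inner_diff_right y_def)
  then have "A *v b = ?q b *\<^sub>R b" unfolding y_def by simp
  with b that show thesis by blast
qed

lemma symmetric_orthonormal_eigenbasis_on_subspace:
  fixes A :: "real ^ 'n ^ 'n"
  assumes sym: "transpose A = A"
  shows "subspace S \<Longrightarrow> (\<And>x. x \<in> S \<Longrightarrow> A *v x \<in> S) \<Longrightarrow>
    \<exists>B\<subseteq>S. pairwise orthogonal B \<and> (\<forall>b\<in>B. norm b = 1 \<and> (\<exists>c. A *v b = c *\<^sub>R b)) \<and> span B = S"
proof (induction "dim S" arbitrary: S rule: less_induct)
  case (less S)
  have symi: "x \<bullet> (A *v y) = (A *v x) \<bullet> y" for x y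
    using inner_transpose_mult[of x A y] sym by simp
  show ?case
  proof (cases "S = {0}")
    case True
    then show ?thesis by (intro exI[of _ "{}"]) auto
  next
    case False
    from symmetric_eigenvector_on_subspace[OF sym less.prems False]
    obtain b c where b: "b \<in> S" "norm b = 1" "A *v b = c *\<^sub>R b" by blast
    \<comment> \<open>Symmetry of \<open>A\<close> and the eigenvector equation for \<open>b\<close>
      make this complement invariant, and its dimension is smaller.\<close>
    define S' where "S' = S \<inter> {y. orthogonal b y}"
    have sub': "subspace S'" unfolding S'_def
      by (intro subspace_inter less.prems subspace_orthogonal_to_vector)
    have inv': "A *v x \<in> S'" if "x \<in> S'" for x
      using that less.prems(2) b(3) unfolding S'_def by (auto simp: orthogonal_def symi)
    have "b \<notin> S'" using b unfolding S'_def by (auto simp: orthogonal_def norm_eq_1)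
    then have "S' \<subset> S" using b unfolding S'_def by auto
    then have "dim S' < dim S"
      using less.prems(1) sub' by (metis dim_psubset span_eq_iff)
    from less.hyps[OF this sub' inv'] obtain B where B: "B \<subseteq> S'" "pairwise orthogonal B"
      "\<And>x. x \<in> B \<Longrightarrow> norm x = 1 \<and> (\<exists>c. A *v x = c *\<^sub>R x)" "span B = S'" by blast
    have "pairwise orthogonal (insert b B)"
      using B(1,2) unfolding S'_def pairwise_insert by (auto simp: orthogonal_commute)
    moreover have "x \<in> span (insert b B)" if x: "x \<in> S" for x
    proof -
      have "x - (x \<bullet> b) *\<^sub>R b \<in> S'" using x b less.prems(1) unfolding S'_def
        by (auto simp: orthogonal_def inner_diff_right norm_eq_1 inner_commute
            intro: subspace_diff subspace_scale)
      then have "x - (x \<bullet> b) *\<^sub>R b \<in> span B" using B(4) by simp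
      then show ?thesis using span_breakdown_eq by blast
    qed
    moreover have ins: "insert b B \<subseteq> S" using B(1) b unfolding S'_def by auto
    then have "span (insert b B) \<subseteq> S" using less.prems(1) by (simp add: span_minimal)
    ultimately show ?thesis using B b ins by (intro exI[of _ "insert b B"]) auto
  qed
qed

theorem symmetric_matrix_diagonalizable:
  fixes A :: "real ^ 'n ^ 'n"
  assumes sym: "transpose A = A"
  obtains P l where "orthogonal_matrix P" "A = P ** diagm l ** transpose P"
proof -
  from symmetric_orthonormal_eigenbasis_on_subspace[OF sym subspace_UNIV] obtain B where
    B: "pairwise orthogonal B" "\<And>b. b \<in> B \<Longrightarrow> norm b = 1" "\<forall>b\<in>B. \<exists>c. A *v b = c *\<^sub>R b"
      "span B = UNIV" by auto
  from bchoice[OF B(3)] obtain c where c: "\<And>b. b \<in> B \<Longrightarrow> A *v b = c b *\<^sub>R b" by blast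
  have ind: "independent B"
    using B(1,2) by (intro pairwise_orthogonal_independent) (metis norm_zero zero_neq_one)+
  then have "finite B" by (rule independent_imp_finite)
  moreover have "card B = CARD('n)"
    using dim_eq_card_independent[OF ind] dim_span[of B] B(4) by simp
  ultimately obtain f where f: "bij_betw f (UNIV :: 'n set) B"
    using finite_same_card_bij[of "UNIV :: 'n set" B] by auto
  define P where "P = (\<chi> i j. f j $ i)"
  have col: "column j P = f j" for j by (simp add: column_def P_def vec_eq_iff)
  have fB: "f j \<in> B" for j using f by (auto simp: bij_betw_def)
  have inj: "f i \<noteq> f j" if "i \<noteq> j" for i j
    using f that by (auto simp: bij_betw_def inj_def)
  have orth: "orthogonal_matrix P"
    unfolding orthogonal_matrix_orthonormal_columns col
    using B(1,2) fB inj by (auto simp: pairwise_def)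
  have "A ** P = P ** diagm (\<lambda>j. c (f j))"
  proof -
    have "(A ** P) $ i $ j = (P ** diagm (\<lambda>j. c (f j))) $ i $ j" for i j
    proof -
      have "(A ** P) $ i $ j = (A *v f j) $ i"
        by (simp add: matrix_matrix_mult_def matrix_vector_mult_def P_def)
      also have "\<dots> = c (f j) * f j $ i" using c[OF fB] by simp
      finally show ?thesis
        by (simp add: matrix_matrix_mult_def P_def if_distrib[where f="\<lambda>x. _ * x"] cong: if_cong)
    qed
    then show ?thesis by (simp add: vec_eq_iff)
  qed
  then have "A ** (P ** transpose P) = P ** diagm (\<lambda>j. c (f j)) ** transpose P"
    by (simp add: matrix_mul_assoc)
  then have "A = P ** diagm (\<lambda>j. c (f j)) ** transpose P"
    using orth by (simp add: orthogonal_matrix_def)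
  with orth that show thesis by blast
qed

text \<open>Whiten \<open>C\<close> with its square root factor \<open>S0\<close>, whose inverse is
  \<open>R\<close>. The transformed \<open>R ** D ** transpose R\<close> is still symmetric, and
  diagonalizing it by an orthogonal \<open>U\<close> does not disturb the identity into which
  \<open>C\<close> was turned. Hence \<open>S = S0 ** U\<close>.\<close>

lemma simultaneous_diagonalization:
  fixes C D :: "real ^ 'n ^ 'n"
  assumes C: "pos_def_matrix C" and D: "transpose D = D"
  obtains S :: "real ^ 'n ^ 'n" and l where "invertible S" "C = S ** transpose S" "D = S ** diagm l ** transpose S"
proof -
  have "transpose C = C" using C by (simp add: pos_def_matrix_def)
  from symmetric_matrix_diagonalizable[OF this] obtain P s where
    P: "orthogonal_matrix P" and CP: "C = P ** diagm s ** transpose P" .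
  have PP: "transpose P ** P = mat 1" "P ** transpose P = mat 1"
    using P by (auto simp: orthogonal_matrix_def)
  have s: "0 < s i" for i
  proof -
    \<comment> \<open>The eigenvector for \<open>s i\<close>; the quadratic form of \<open>C\<close>
      takes the value \<open>s i\<close> there.\<close>
    define x where "x = P *v axis i 1"
    have Px: "transpose P *v x = axis i 1"
      by (simp del: transpose_matrix_vector add: x_def matrix_vector_mul_assoc PP)
    then have "x \<noteq> 0" by (metis axis_eq_0_iff matrix_vector_mult_0_right zero_neq_one)
    then have "0 < x \<bullet> (C *v x)" using C by (simp add: pos_def_matrix_def)
    also have "x \<bullet> (C *v x) = x \<bullet> (P *v (diagm s *v (transpose P *v x)))"
      by (simp del: transpose_matrix_vector add: CP matrix_vector_mul_assoc matrix_mul_assoc)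
    also have "\<dots> = (transpose P *v x) \<bullet> (diagm s *v (transpose P *v x))"
      using inner_transpose_mult[of x "transpose P"] by simp
    also have "\<dots> = s i" unfolding Px inner_axis' diagm_mult_vec by (simp add: axis_def)
    finally show ?thesis .
  qed
  define S0 where "S0 = P ** diagm (\<lambda>i. sqrt (s i))"
  define R where "R = diagm (\<lambda>i. 1 / sqrt (s i)) ** transpose P"
  have SR: "S0 ** R = mat 1"
  proof -
    have "S0 ** R = P ** (diagm (\<lambda>i. sqrt (s i)) ** diagm (\<lambda>i. 1 / sqrt (s i))) ** transpose P"
      by (simp add: S0_def R_def matrix_mul_assoc)
    also have "\<dots> = mat 1" using s by (simp add: diagm_mult PP less_imp_neq[OF s, symmetric])
    finally show ?thesis .
  qed
  have C0: "C = S0 ** transpose S0"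
  proof -
    have "S0 ** transpose S0 = P ** (diagm (\<lambda>i. sqrt (s i)) ** diagm (\<lambda>i. sqrt (s i))) ** transpose P"
      by (simp add: S0_def matrix_transpose_mul matrix_mul_assoc)
    also have "\<dots> = C" using s by (simp add: diagm_mult CP less_imp_le)
    finally show ?thesis ..
  qed
  have "transpose (R ** D ** transpose R) = R ** D ** transpose R"
    by (simp add: matrix_transpose_mul D matrix_mul_assoc)
  from symmetric_matrix_diagonalizable[OF this] obtain U l where
    U: "orthogonal_matrix U" and RU: "R ** D ** transpose R = U ** diagm l ** transpose U" .
  define S where "S = S0 ** U"
  have "invertible S0" using SR invertible_right_inverse by blast
  moreover have "invertible U" using U unfolding orthogonal_matrix_def invertible_def by blast
  ultimately have "invertible S" unfolding S_def by (rule invertible_mult)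
  moreover have "C = S ** transpose S"
  proof -
    have "S ** transpose S = S0 ** (U ** transpose U) ** transpose S0"
      by (simp add: S_def matrix_transpose_mul matrix_mul_assoc)
    then show ?thesis using U C0 by (simp add: orthogonal_matrix_def)
  qed
  moreover have "D = S ** diagm l ** transpose S"
  proof -
    have "S ** diagm l ** transpose S = S0 ** (U ** diagm l ** transpose U) ** transpose S0"
      by (simp add: S_def matrix_transpose_mul matrix_mul_assoc)
    also have "\<dots> = (S0 ** R) ** D ** transpose (S0 ** R)"
      unfolding RU[symmetric] by (simp add: matrix_transpose_mul matrix_mul_assoc)
    also have "\<dots> = D" by (simp add: SR)
    finally show ?thesis ..
  qed
  ultimately show thesis using that by blast
qed

section \<open>Eigenvalues of compressions\<close>

lemma matrix_diff_mult: "(A - B) ** C = A ** C - B ** C" for A B :: "'a::ring_1 ^ 'n ^ 'm"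
  by (simp add: vec_eq_iff matrix_matrix_mult_def algebra_simps sum_subtractf)

lemma matrix_inv_eqI:
  fixes A :: "real ^ 'n ^ 'n"
  assumes "A ** B = mat 1"
  shows "matrix_inv A = B"
proof -
  have BA: "B ** A = mat 1" using assms matrix_left_right_inverse by blast
  have "A ** matrix_inv A = mat 1 \<and> matrix_inv A ** A = mat 1"
    unfolding matrix_inv_def by (rule someI[of _ B]) (simp add: assms BA)
  then have "B ** (A ** matrix_inv A) = B" by simp
  then show ?thesis by (simp add: matrix_mul_assoc BA)
qed

lemma poly_det: "poly (det M) x = det (\<chi> i j. poly (M $ i $ j) x)"
  by (simp add: det_def poly_sum poly_prod)

lemma poly_charpoly: "poly (charpoly A) x = det (mat x - A)"
  unfolding charpoly_def poly_det
  by (intro arg_cong[where f=det]) (simp add: vec_eq_iff mat_def)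

text \<open>Similar matrices have the same characteristic polynomial. Real polynomials are
  determined by their values, so it suffices to take determinants at each real \<open>x\<close> and
  cancel \<open>det W\<close>.\<close>

lemma eigenvalue_family_of_diagonalization:
  fixes A W :: "real ^ 'm ^ 'm"
  assumes W: "invertible W" and AW: "A ** W = W ** diagm d"
  shows "eigenvalue_family A d"
proof -
  have "poly (charpoly A) x = poly (\<Prod>i\<in>UNIV. [:- d i, 1:]) x" for x
  proof -
    have "(mat x - A) ** W = W ** diagm (\<lambda>i. x - d i)"
    proof -
      have "(mat x - A) ** W = mat x ** W - A ** W"
        by (rule matrix_diff_mult)
      moreover have "W ** diagm (\<lambda>i. x - d i) = mat x ** W - W ** diagm d"
        by (simp add: vec_eq_iff matrix_matrix_mult_def mat_def if_distrib[where f="\<lambda>x. _ * x"]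
            if_distrib[where f="\<lambda>x. x * _"] algebra_simps cong: if_cong)
      ultimately show ?thesis using AW by simp
    qed
    then have "det (mat x - A) * det W = det W * (\<Prod>i\<in>UNIV. x - d i)"
      by (metis det_mul det_diagm)
    moreover have "det W \<noteq> 0" using W by (simp add: invertible_det_nz)
    ultimately show ?thesis by (simp add: poly_charpoly poly_prod)
  qed
  then show ?thesis unfolding eigenvalue_family_def by (simp add: poly_eq_poly_eq_iff[symmetric] fun_eq_iff)
qed

text \<open>Both families list the roots of one polynomial with multiplicity, so they agree up to
  order. This allows the given eigenvalues to be replaced by computed ones in any symmetric
  sum.\<close>

lemma eigenvalue_family_unique:
  assumes "eigenvalue_family A r" "eigenvalue_family A r'"
  shows "image_mset r (mset_set UNIV) = image_mset r' (mset_set UNIV)"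
proof -
  have "proots (\<Prod>i\<in>UNIV. [:- s i, 1:]) = image_mset s (mset_set UNIV)" for s :: "'a \<Rightarrow> real"
    by (subst proots_prod) (auto simp: sum_unfold_sum_mset)
  then show ?thesis using assms unfolding eigenvalue_family_def by metis
qed

lemma eigenvalue_family_sum_eq:
  assumes "eigenvalue_family A r" "eigenvalue_family A r'"
  shows "(\<Sum>i\<in>UNIV. f (r i)) = (\<Sum>i\<in>UNIV. f (r' i))"
proof -
  have "(\<Sum>i\<in>UNIV. f (s i)) = sum_mset (image_mset f (image_mset s (mset_set UNIV)))" for s :: "'a \<Rightarrow> real"
    by (simp add: sum_unfold_sum_mset multiset.map_comp comp_def)
  then show ?thesis using eigenvalue_family_unique[OF assms] by simp
qed

text \<open>Injectivity of the column family turns independence of the column set into full column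
  rank: repeated columns would lower the cardinality.\<close>

lemma columns_basis_of_mult_nonzero:
  fixes B :: "real ^ 'm ^ 'n"
  assumes "columns_basis_of B V" "x \<noteq> 0"
  shows "B *v x \<noteq> 0"
proof -
  have "columns B = range (\<lambda>j. column j B)" by (auto simp: columns_def)
  then have "card (columns B) = CARD('m)"
    using assms by (simp add: columns_basis_of_def card_image)
  then have "rank B = CARD('m)"
    using assms dim_eq_card_independent[of "columns B"] by (simp add: column_rank_def columns_basis_of_def)
  then have "inj ((*v) B)" by (simp add: full_rank_injective)
  then show ?thesis using assms(2) by (metis injD matrix_vector_mult_0_right)
qed

section \<open>Compression by a matrix with orthonormal columns\<close>

text \<open>Let r be the squared norm of row k. Applying the isometry \<open>G\<close> to that row
  gives a vector of squared norm r whose k-th coordinate is r, so r squared is at most r.\<close>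

lemma row_norm_le_1:
  fixes G :: "real ^ 'm ^ 'n"
  assumes G: "transpose G ** G = mat 1"
  shows "(\<Sum>i\<in>UNIV. (G $ k $ i)\<^sup>2) \<le> 1"
proof -
  let ?r = "\<Sum>i\<in>UNIV. (G $ k $ i)\<^sup>2"
  let ?g = "G $ k"
  have r: "?g \<bullet> ?g = ?r" by (simp add: inner_vec_def power2_eq_square)
  have "(G *v ?g) \<bullet> (G *v ?g) = ?g \<bullet> ((transpose G ** G) *v ?g)"
    by (metis inner_transpose_mult matrix_vector_mul_assoc)
  then have "(norm (G *v ?g))\<^sup>2 = ?r" using G r by (simp add: power2_norm_eq_inner)
  moreover have "\<bar>(G *v ?g) $ k\<bar> \<le> norm (G *v ?g)" by (rule component_le_norm_cart)
  moreover have "(G *v ?g) $ k = ?r" using r by (simp add: matrix_vector_mul_component)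
  ultimately have le: "?r\<^sup>2 \<le> ?r" by (metis abs_le_square_iff abs_norm_cancel)
  show ?thesis
  proof (rule ccontr)
    assume "\<not> ?r \<le> 1"
    then have "?r * 1 < ?r * ?r" by (intro mult_strict_left_mono) auto
    with le show False by (simp add: power2_eq_square)
  qed
qed

text \<open>The inner sums are the diagonal entries of \<open>transpose G ** diagm n ** G\<close>.
  Each column of \<open>G\<close> has squared entries summing to 1, so Cauchy-Schwarz acts as
  Jensen's inequality; summing over the columns leaves the row norms, which are at most 1.\<close>

lemma sum_squares_compression_le:
  fixes G :: "real ^ 'm ^ 'n"
  assumes G: "transpose G ** G = mat 1"
  shows "(\<Sum>i\<in>UNIV. (\<Sum>k\<in>UNIV. n k * (G $ k $ i)\<^sup>2)\<^sup>2) \<le> (\<Sum>k\<in>UNIV. (n k)\<^sup>2)"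
proof -
  have col: "(\<Sum>k\<in>UNIV. (G $ k $ i)\<^sup>2) = 1" for i
  proof -
    have "(transpose G ** G) $ i $ i = (\<Sum>k\<in>UNIV. (G $ k $ i)\<^sup>2)"
      by (simp add: matrix_matrix_mult_def transpose_def power2_eq_square)
    then show ?thesis using G by (simp add: mat_def)
  qed
  have "(\<Sum>i\<in>UNIV. (\<Sum>k\<in>UNIV. n k * (G $ k $ i)\<^sup>2)\<^sup>2)
      \<le> (\<Sum>i\<in>UNIV. \<Sum>k\<in>UNIV. (n k)\<^sup>2 * (G $ k $ i)\<^sup>2)"
  proof (rule sum_mono)
    fix i
    have "(\<Sum>k\<in>UNIV. n k * (G $ k $ i)\<^sup>2)\<^sup>2 = (\<Sum>k\<in>UNIV. (n k * G $ k $ i) * G $ k $ i)\<^sup>2"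
      by (simp add: power2_eq_square mult.assoc)
    also have "\<dots> \<le> (\<Sum>k\<in>UNIV. (n k * G $ k $ i)\<^sup>2) * (\<Sum>k\<in>UNIV. (G $ k $ i)\<^sup>2)"
      by (rule Cauchy_Schwarz_ineq_sum)
    finally show "(\<Sum>k\<in>UNIV. n k * (G $ k $ i)\<^sup>2)\<^sup>2 \<le> (\<Sum>k\<in>UNIV. (n k)\<^sup>2 * (G $ k $ i)\<^sup>2)"
      by (simp add: col power_mult_distrib)
  qed
  also have "\<dots> = (\<Sum>k\<in>UNIV. (n k)\<^sup>2 * (\<Sum>i\<in>UNIV. (G $ k $ i)\<^sup>2))"
    by (subst sum.swap) (simp add: sum_distrib_left)
  also have "\<dots> \<le> (\<Sum>k\<in>UNIV. (n k)\<^sup>2 * 1)"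
    by (intro sum_mono mult_left_mono row_norm_le_1[OF G]) auto
  finally show ?thesis by simp
qed

text \<open>After a change of basis that makes the compressed \<open>S1\<close> the identity, the
  compressed \<open>S2\<close> is diagonal with entries \<open>d\<close>, and the eigenvalues in
  question are the \<open>d i - 1\<close>. The same change of basis exhibits \<open>diagm d\<close>
  as a compression of \<open>diagm l\<close> by a matrix \<open>G\<close> with orthonormal
  columns.\<close>

lemma compressed_eigenvalues_sum_squares_le:
  fixes T :: "real ^ 'n ^ 'n" and B :: "real ^ 'm ^ 'n"
  assumes T: "invertible T" and B: "\<And>x. x \<noteq> 0 \<Longrightarrow> B *v x \<noteq> 0"
    and S1: "S1 = T ** transpose T" and S2: "S2 = T ** diagm l ** transpose T"
    and ev: "eigenvalue_family
      (matrix_inv (transpose B ** S1 ** B) ** (transpose B ** S2 ** B) - mat 1) \<rho>"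
  shows "(\<Sum>i\<in>UNIV. (\<rho> i)\<^sup>2) \<le> (\<Sum>k\<in>UNIV. (l k - 1)\<^sup>2)"
proof -
  define F where "F = transpose T ** B"
  define C where "C = transpose B ** S1 ** B"
  define D where "D = transpose B ** S2 ** B"
  have CF: "C = transpose F ** F" and DF: "D = transpose F ** diagm l ** F"
    by (simp_all add: C_def D_def F_def S1 S2 matrix_transpose_mul matrix_mul_assoc)
  obtain T' where T': "T ** T' = mat 1" "T' ** T = mat 1" using T unfolding invertible_def by blast
  have F0: "F *v x \<noteq> 0" if "x \<noteq> 0" for x
  proof
    assume "F *v x = 0"
    then have "transpose T' *v (F *v x) = 0" by (simp del: transpose_matrix_vector)
    moreover have "transpose T' ** F = B"
      unfolding F_def matrix_mul_assoc matrix_transpose_mul[symmetric] by (simp add: T')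
    ultimately show False using B[OF that] by (simp add: matrix_vector_mul_assoc del: transpose_matrix_vector)
  qed
  have "pos_def_matrix C"
    unfolding pos_def_matrix_def
  proof (intro conjI allI impI)
    show "transpose C = C" by (simp add: CF matrix_transpose_mul)
    fix x :: "real ^ 'm" assume "x \<noteq> 0"
    have "x \<bullet> (C *v x) = (F *v x) \<bullet> (F *v x)"
      by (metis CF inner_transpose_mult matrix_vector_mul_assoc)
    then show "0 < x \<bullet> (C *v x)" using F0[OF \<open>x \<noteq> 0\<close>] by simp
  qed
  moreover have "transpose D = D" by (simp add: DF matrix_transpose_mul matrix_mul_assoc)
  ultimately obtain S :: "real ^ 'm ^ 'm" and d where S: "invertible S" and CS: "C = S ** transpose S"
    and DS: "D = S ** diagm d ** transpose S"
    by (rule simultaneous_diagonalization)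
  obtain R where R: "S ** R = mat 1" "R ** S = mat 1" using S unfolding invertible_def by blast
  have RT: "transpose S ** transpose R = mat 1" "transpose R ** transpose S = mat 1"
    by (simp_all add: matrix_transpose_mul[symmetric] R)
  have "C ** (transpose R ** R) = S ** (transpose S ** transpose R) ** R"
    by (simp add: CS matrix_mul_assoc)
  then have Cinv: "matrix_inv C = transpose R ** R"
    by (intro matrix_inv_eqI) (simp add: RT R)
  \<comment> \<open>\<open>matrix_inv C ** D\<close> need not be symmetric, but the columns of
    \<open>transpose R\<close> form an eigenbasis for it.\<close>
  have "(matrix_inv C ** D - mat 1) ** transpose R = transpose R ** diagm (\<lambda>i. d i - 1)"
  proof -
    have "(matrix_inv C ** D - mat 1) ** transpose R = matrix_inv C ** D ** transpose R - transpose R"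
      by (simp add: matrix_diff_mult)
    also have "matrix_inv C ** D ** transpose R
        = transpose R ** (R ** S) ** diagm d ** (transpose S ** transpose R)"
      by (simp add: Cinv DS matrix_mul_assoc)
    also have "\<dots> = transpose R ** diagm d" by (simp add: R RT)
    also have "\<dots> - transpose R = transpose R ** diagm (\<lambda>i. d i - 1)"
      by (simp add: vec_eq_iff matrix_matrix_mult_def if_distrib[where f="\<lambda>x. _ * x"]
            algebra_simps cong: if_cong)
    finally show ?thesis .
  qed
  moreover have "invertible (transpose R)" using RT unfolding invertible_def by blast
  ultimately have "eigenvalue_family (matrix_inv C ** D - mat 1) (\<lambda>i. d i - 1)"
    by (intro eigenvalue_family_of_diagonalization)
  with ev have sum_eq: "(\<Sum>i\<in>UNIV. (\<rho> i)\<^sup>2) = (\<Sum>i\<in>UNIV. (d i - 1)\<^sup>2)"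
    unfolding C_def D_def by (rule eigenvalue_family_sum_eq[where f="\<lambda>x. x\<^sup>2"])
  define G where "G = F ** transpose R"
  have "transpose G ** G = R ** C ** transpose R"
    by (simp add: G_def CF matrix_transpose_mul matrix_mul_assoc)
  also have "\<dots> = (R ** S) ** (transpose S ** transpose R)" by (simp add: CS matrix_mul_assoc)
  finally have GG: "transpose G ** G = mat 1" by (simp add: R RT)
  have "transpose G ** diagm l ** G = R ** D ** transpose R"
    by (simp add: G_def DF matrix_transpose_mul matrix_mul_assoc)
  also have "\<dots> = (R ** S) ** diagm d ** (transpose S ** transpose R)" by (simp add: DS matrix_mul_assoc)
  finally have GD: "transpose G ** diagm l ** G = diagm d" by (simp add: R RT)
  have "d i - 1 = (\<Sum>k\<in>UNIV. (l k - 1) * (G $ k $ i)\<^sup>2)" for i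
  proof -
    have "d i = (transpose G ** diagm l ** G) $ i $ i" by (simp add: GD)
    also have "\<dots> = (\<Sum>k\<in>UNIV. l k * (G $ k $ i)\<^sup>2)"
      by (simp add: matrix_matrix_mult_def transpose_def if_distrib[where f="\<lambda>x. _ * x"]
          power2_eq_square mult_ac cong: if_cong)
    finally have "d i = (\<Sum>k\<in>UNIV. l k * (G $ k $ i)\<^sup>2)" .
    \<comment> \<open>The unit column norm is what lets the 1 be subtracted inside the sum.\<close>
    moreover have "1 = (\<Sum>k\<in>UNIV. (G $ k $ i)\<^sup>2)"
    proof -
      have "1 = (transpose G ** G) $ i $ i" by (simp add: GG mat_def)
      then show ?thesis by (simp add: matrix_matrix_mult_def transpose_def power2_eq_square)
    qed
    ultimately show ?thesis by (simp add: algebra_simps sum_subtractf)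
  qed
  then show ?thesis using sum_squares_compression_le[OF GG, of "\<lambda>k. l k - 1"] sum_eq by simp
qed

section \<open>Linear change of variables for Lebesgue measure\<close>

lemma measurable_matrix_vector_mult [measurable]: "(\<lambda>x. A *v x) \<in> borel \<rightarrow>\<^sub>M borel"
  for A :: "real ^ 'n ^ 'm"
  by (intro borel_measurable_continuous_onI matrix_vector_mult_linear_continuous_on)

lemma nn_integral_lborel_translation:
  fixes f :: "'a::euclidean_space \<Rightarrow> ennreal"
  assumes [measurable]: "f \<in> borel_measurable borel" and c: "\<bar>c\<bar> = 1"
  shows "(\<integral>\<^sup>+x. f (t + c *\<^sub>R x) \<partial>lborel) = (\<integral>\<^sup>+x. f x \<partial>lborel)"
proof -
  have "lborel = distr lborel borel (\<lambda>x::'a. t + c *\<^sub>R x)"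
    using lborel_affine[of c t] c by (auto simp: density_1)
  then have "(\<integral>\<^sup>+x. f x \<partial>lborel) = (\<integral>\<^sup>+x. f x \<partial>distr lborel borel (\<lambda>x::'a. t + c *\<^sub>R x))"
    by simp
  then show ?thesis by (simp add: nn_integral_distr)
qed

text \<open>By Fubini and translation invariance, both sides equal the double integral of
  \<open>f (T x + y) * g y\<close>. Taking a Gaussian for \<open>g\<close> identifies the scaling factor of \<open>T\<close>.\<close>

lemma nn_integral_lborel_linear_exchange:
  fixes T T' :: "real ^ 'n ^ 'n" and f g :: "real ^ 'n \<Rightarrow> ennreal"
  assumes [measurable]: "f \<in> borel_measurable borel" "g \<in> borel_measurable borel"
    and T: "T ** T' = mat 1"
  shows "(\<integral>\<^sup>+x. f (T *v x) \<partial>lborel) * (\<integral>\<^sup>+y. g y \<partial>lborel)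
    = (\<integral>\<^sup>+x. g (T *v x) \<partial>lborel) * (\<integral>\<^sup>+y. f y \<partial>lborel)"
proof -
  have TT: "T *v (T' *v y) = y" for y by (simp add: matrix_vector_mul_assoc T)
  \<comment> \<open>The shift by \<open>y\<close> outside \<open>T\<close> is a shift by
    \<open>T' *v y\<close> inside it. The next fact also reflects \<open>x\<close>, which is why the
    translation lemma admits \<open>c = -1\<close>.\<close>
  have 1: "(\<integral>\<^sup>+x. f (T *v x + y) \<partial>lborel) = (\<integral>\<^sup>+x. f (T *v x) \<partial>lborel)" for y
    using nn_integral_lborel_translation[of "\<lambda>x. f (T *v x)" 1 "T' *v y"]
    by (simp add: matrix_vector_right_distrib TT add.commute)
  have 2: "(\<integral>\<^sup>+x. g (y - T *v x) \<partial>lborel) = (\<integral>\<^sup>+x. g (T *v x) \<partial>lborel)" for y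
    using nn_integral_lborel_translation[of "\<lambda>x. g (T *v x)" "-1" "T' *v y"]
    by (simp add: matrix_vector_mult_diff_distrib TT)
  have 3: "(\<integral>\<^sup>+y. f (T *v x + y) * g y \<partial>lborel) = (\<integral>\<^sup>+y. f y * g (y - T *v x) \<partial>lborel)" for x
    using nn_integral_lborel_translation[of "\<lambda>y. f y * g (y - T *v x)" 1 "T *v x"] by simp
  have "(\<integral>\<^sup>+x. f (T *v x) \<partial>lborel) * (\<integral>\<^sup>+y. g y \<partial>lborel)
      = (\<integral>\<^sup>+y. \<integral>\<^sup>+x. f (T *v x + y) * g y \<partial>lborel \<partial>lborel)"
    by (simp add: nn_integral_multc nn_integral_cmult 1)
  also have "\<dots> = (\<integral>\<^sup>+x. \<integral>\<^sup>+y. f (T *v x + y) * g y \<partial>lborel \<partial>lborel)"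
    by (rule lborel_pair.Fubini') simp
  also have "\<dots> = (\<integral>\<^sup>+x. \<integral>\<^sup>+y. f y * g (y - T *v x) \<partial>lborel \<partial>lborel)" by (simp add: 3)
  also have "\<dots> = (\<integral>\<^sup>+y. \<integral>\<^sup>+x. f y * g (y - T *v x) \<partial>lborel \<partial>lborel)"
    by (rule lborel_pair.Fubini'[symmetric]) simp
  also have "\<dots> = (\<integral>\<^sup>+x. g (T *v x) \<partial>lborel) * (\<integral>\<^sup>+y. f y \<partial>lborel)"
    by (simp add: nn_integral_multc nn_integral_cmult 2 mult.commute)
  finally show ?thesis .
qed

lemma nn_integral_lborel_vec_prod:
  fixes f :: "'n::finite \<Rightarrow> real \<Rightarrow> ennreal"
  assumes [measurable]: "\<And>i. f i \<in> borel_measurable borel"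
  shows "(\<integral>\<^sup>+x. (\<Prod>i\<in>UNIV. f i (x $ i)) \<partial>lborel) = (\<Prod>i\<in>UNIV. \<integral>\<^sup>+x. f i x \<partial>lborel)"
proof -
  let ?a = "\<lambda>i. axis i 1 :: real ^ 'n"
  have bij: "bij_betw ?a UNIV Basis"
    by (auto simp: bij_betw_def inj_def Basis_vec_def axis_eq_axis)
  define g where "g b = f (the_inv_into UNIV ?a b)" for b
  have g: "g (?a i) = f i" for i
    unfolding g_def using bij the_inv_f_f[of ?a i] by (simp add: bij_betw_def)
  have "(\<integral>\<^sup>+x. (\<Prod>b\<in>Basis. g b (x \<bullet> b)) \<partial>lborel) = (\<Prod>b\<in>Basis. \<integral>\<^sup>+x. g b x \<partial>lborel)"
    by (rule nn_integral_lborel_prod) (simp_all add: g_def)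
  then show ?thesis
    by (simp add: prod.reindex_bij_betw[OF bij, symmetric] g inner_axis)
qed

section \<open>Gaussian integrals and the determinant as scaling factor\<close>

lemma nn_integral_exp_square:
  assumes "0 < k"
  shows "(\<integral>\<^sup>+x. ennreal (exp (- (k * x)\<^sup>2 / 2)) \<partial>lborel) = ennreal (sqrt (2 * pi) / k)"
proof -
  have eq: "exp (- (k * x)\<^sup>2 / 2) = sqrt (2 * pi) / k * normal_density 0 (1 / k) x" for x
    using assms by (simp add: normal_density_def real_sqrt_mult real_sqrt_divide power_divide power_mult_distrib field_simps)
  have "(\<integral>\<^sup>+x. ennreal (normal_density 0 (1 / k) x) \<partial>lborel) = 1"
    using assms by (subst nn_integral_eq_integral) auto
  then show ?thesis
    unfolding eq using assms by (subst ennreal_mult) (auto simp: nn_integral_cmult)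
qed

lemma norm_diagm_mult: "(norm (diagm k *v x))\<^sup>2 = (\<Sum>i\<in>UNIV. (k i * x $ i)\<^sup>2)"
  unfolding power2_norm_eq_inner by (simp add: inner_vec_def diagm_mult_vec power2_eq_square)

lemma nn_integral_exp_diagonal:
  fixes k :: "'n::finite \<Rightarrow> real"
  assumes "\<And>i. 0 < k i"
  shows "(\<integral>\<^sup>+x. ennreal (exp (- (norm (diagm k *v x))\<^sup>2 / 2)) \<partial>lborel)
    = ennreal (\<Prod>i\<in>UNIV. sqrt (2 * pi) / k i)"
proof -
  have "ennreal (exp (- (norm (diagm k *v x))\<^sup>2 / 2)) = (\<Prod>i\<in>UNIV. ennreal (exp (- (k i * x $ i)\<^sup>2 / 2)))" for x
    unfolding norm_diagm_mult by (simp add: prod_ennreal exp_sum[symmetric] sum_divide_distrib sum_negf)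
  then have "(\<integral>\<^sup>+x. ennreal (exp (- (norm (diagm k *v x))\<^sup>2 / 2)) \<partial>lborel)
      = (\<integral>\<^sup>+x. (\<Prod>i\<in>UNIV. ennreal (exp (- (k i * x $ i)\<^sup>2 / 2))) \<partial>lborel)"
    by (rule nn_integral_cong)
  also have "\<dots> = (\<Prod>i\<in>UNIV. \<integral>\<^sup>+x. ennreal (exp (- (k i * x)\<^sup>2 / 2)) \<partial>lborel)"
    by (rule nn_integral_lborel_vec_prod) simp
  also have "\<dots> = (\<Prod>i\<in>UNIV. ennreal (sqrt (2 * pi) / k i))"
    using assms by (simp only: nn_integral_exp_square)
  finally show ?thesis using assms by (simp add: prod_ennreal less_imp_le)
qed

lemma norm_orthogonal_matrix_mult:
  fixes Q :: "real ^ 'n ^ 'n"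
  assumes "orthogonal_matrix Q"
  shows "norm (Q *v x) = norm x"
  using assms orthogonal_transformation_matrix[of "(*v) Q"] by (simp add: orthogonal_transformation)

lemma ennreal_mult_ennreal_cancel:
  assumes "0 < c" "a * ennreal c = b * ennreal c"
  shows "a = b"
proof -
  have "x = x * ennreal c * ennreal (1 / c)" for x
    using assms(1) by (simp add: mult.assoc ennreal_mult[symmetric])
  then show ?thesis using assms(2) by metis
qed

text \<open>In the exchange identity the Gaussian is rotation invariant, and its integral is
  positive and finite, so it cancels.\<close>

lemma nn_integral_lborel_orthogonal:
  fixes Q :: "real ^ 'n ^ 'n" and f :: "real ^ 'n \<Rightarrow> ennreal"
  assumes [measurable]: "f \<in> borel_measurable borel" and Q: "orthogonal_matrix Q"
  shows "(\<integral>\<^sup>+x. f (Q *v x) \<partial>lborel) = (\<integral>\<^sup>+x. f x \<partial>lborel)"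
proof -
  let ?g = "\<lambda>x::real ^ 'n. ennreal (exp (- (norm x)\<^sup>2 / 2))"
  have "(\<integral>\<^sup>+x. f (Q *v x) \<partial>lborel) * (\<integral>\<^sup>+y. ?g y \<partial>lborel)
    = (\<integral>\<^sup>+x. ?g (Q *v x) \<partial>lborel) * (\<integral>\<^sup>+y. f y \<partial>lborel)"
    using Q by (intro nn_integral_lborel_linear_exchange[where T'="transpose Q"])
      (auto simp: orthogonal_matrix_def)
  also have "\<dots> = (\<integral>\<^sup>+y. f y \<partial>lborel) * (\<integral>\<^sup>+y. ?g y \<partial>lborel)"
    by (simp add: norm_orthogonal_matrix_mult[OF Q] mult.commute)
  finally have eq: "(\<integral>\<^sup>+x. f (Q *v x) \<partial>lborel) * (\<integral>\<^sup>+y. ?g y \<partial>lborel)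
    = (\<integral>\<^sup>+y. f y \<partial>lborel) * (\<integral>\<^sup>+y. ?g y \<partial>lborel)" .
  have c: "(\<integral>\<^sup>+y. ?g y \<partial>lborel) = ennreal (\<Prod>i\<in>(UNIV::'n set). sqrt (2 * pi))"
    using nn_integral_exp_diagonal[of "\<lambda>i::'n. 1"] by simp
  show ?thesis
    using eq unfolding c by (rule ennreal_mult_ennreal_cancel[rotated]) (simp add: prod_pos)
qed

text \<open>By the exchange identity only the integral of one Gaussian composed with
  \<open>T\<close> has to be known. Diagonalizing \<open>transpose T ** T\<close> and removing the
  orthogonal factor by the previous lemma turns it into a product of one-dimensional
  integrals.\<close>

theorem nn_integral_lborel_linear:
  fixes T :: "real ^ 'n ^ 'n" and f :: "real ^ 'n \<Rightarrow> ennreal"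
  assumes f [measurable]: "f \<in> borel_measurable borel" and T: "invertible T"
  shows "ennreal \<bar>det T\<bar> * (\<integral>\<^sup>+x. f (T *v x) \<partial>lborel) = (\<integral>\<^sup>+x. f x \<partial>lborel)"
proof -
  let ?g = "\<lambda>x::real ^ 'n. ennreal (exp (- (norm x)\<^sup>2 / 2))"
  define c where "c = (\<Prod>i\<in>(UNIV::'n set). sqrt (2 * pi))"
  have cpos: "0 < c" by (simp add: c_def prod_pos)
  have g: "(\<integral>\<^sup>+y. ?g y \<partial>lborel) = ennreal c"
    using nn_integral_exp_diagonal[of "\<lambda>i::'n. 1"] by (simp add: c_def)
  have "transpose (transpose T ** T) = transpose T ** T" by (simp add: matrix_transpose_mul)
  from symmetric_matrix_diagonalizable[OF this] obtain P s where
    P: "orthogonal_matrix P" and TP: "transpose T ** T = P ** diagm s ** transpose P" .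
  have norm: "(norm (T *v x))\<^sup>2 = (\<Sum>i\<in>UNIV. s i * ((transpose P *v x) $ i)\<^sup>2)" for x
  proof -
    have "(norm (T *v x))\<^sup>2 = x \<bullet> ((transpose T ** T) *v x)"
      unfolding power2_norm_eq_inner by (metis inner_transpose_mult matrix_vector_mul_assoc)
    also have "\<dots> = x \<bullet> (transpose (transpose P) *v (diagm s *v (transpose P *v x)))"
      by (simp del: transpose_matrix_vector add: TP matrix_vector_mul_assoc matrix_mul_assoc)
    also have "\<dots> = (transpose P *v x) \<bullet> (diagm s *v (transpose P *v x))"
      by (rule inner_transpose_mult)
    finally show ?thesis
      by (simp add: inner_vec_def diagm_mult_vec power2_eq_square mult_ac del: transpose_matrix_vector)
  qed
  have s: "0 < s i" for i
  proof -
    have "transpose P *v (P *v axis i 1) = axis i 1"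
      using P by (simp add: matrix_vector_mul_assoc orthogonal_matrix_def del: transpose_matrix_vector)
    then have "(norm (T *v (P *v axis i 1)))\<^sup>2 = s i"
      unfolding norm by (simp add: axis_def if_distrib[where f="\<lambda>x. x\<^sup>2"] if_distrib[where f="\<lambda>x. _ * x"] cong: if_cong)
    moreover have "T *v (P *v axis i 1) \<noteq> 0"
    proof
      assume "T *v (P *v axis i 1) = 0"
      then have "P *v axis i 1 = 0"
        using T invertible_eq_bij bij_is_inj[of "(*v) T"] by (metis injD matrix_vector_mult_0_right)
      then have "norm (axis i 1 :: real ^ 'n) = 0"
        using norm_orthogonal_matrix_mult[OF P] by (metis norm_zero)
      then show False by (simp add: axis_eq_0_iff)
    qed
    ultimately show ?thesis by (metis zero_less_norm_iff zero_less_power)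
  qed
  have detT: "\<bar>det T\<bar> = (\<Prod>i\<in>UNIV. sqrt (s i))"
  proof -
    have "det P * det P = det (P ** transpose P)" by (simp add: det_mul)
    also have "\<dots> = 1" using P by (simp add: orthogonal_matrix_def)
    moreover have "det (transpose T ** T) = det (diagm s) * (det P * det P)"
      by (simp add: TP det_mul)
    ultimately have "(det T)\<^sup>2 = (\<Prod>i\<in>UNIV. s i)"
      by (simp add: det_mul det_diagm power2_eq_square)
    then have "\<bar>det T\<bar> = sqrt (\<Prod>i\<in>UNIV. s i)" by (metis real_sqrt_abs)
    moreover have "(\<Prod>i\<in>UNIV. sqrt (s i))\<^sup>2 = (\<Prod>i\<in>UNIV. s i)"
      using s by (simp add: prod_power_distrib less_imp_le)
    then have "sqrt (\<Prod>i\<in>UNIV. s i) = (\<Prod>i\<in>UNIV. sqrt (s i))"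
      using s by (intro real_sqrt_unique) (auto intro!: prod_nonneg simp: less_imp_le)
    ultimately show ?thesis by simp
  qed
  have "(\<integral>\<^sup>+x. ?g (T *v x) \<partial>lborel)
      = (\<integral>\<^sup>+x. ennreal (exp (- (norm (diagm (\<lambda>i. sqrt (s i)) *v (transpose P *v x)))\<^sup>2 / 2)) \<partial>lborel)"
    unfolding norm norm_diagm_mult by (simp add: power_mult_distrib s less_imp_le)
  also have "\<dots> = (\<integral>\<^sup>+x. ennreal (exp (- (norm (diagm (\<lambda>i. sqrt (s i)) *v x))\<^sup>2 / 2)) \<partial>lborel)"
    using P by (intro nn_integral_lborel_orthogonal[of "\<lambda>x. ennreal (exp (- (norm (diagm (\<lambda>i. sqrt (s i)) *v x))\<^sup>2 / 2))"]) auto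
  also have "\<dots> = ennreal (c / \<bar>det T\<bar>)"
    using s nn_integral_exp_diagonal[of "\<lambda>i. sqrt (s i)"] by (simp add: c_def detT prod_dividef)
  finally have gT: "(\<integral>\<^sup>+x. ?g (T *v x) \<partial>lborel) = ennreal (c / \<bar>det T\<bar>)" .
  obtain T' where "T ** T' = mat 1" using T unfolding invertible_def by blast
  then have "(\<integral>\<^sup>+x. f (T *v x) \<partial>lborel) * (\<integral>\<^sup>+y. ?g y \<partial>lborel)
    = (\<integral>\<^sup>+x. ?g (T *v x) \<partial>lborel) * (\<integral>\<^sup>+y. f y \<partial>lborel)"
    by (intro nn_integral_lborel_linear_exchange) auto
  then have "ennreal \<bar>det T\<bar> * ((\<integral>\<^sup>+x. f (T *v x) \<partial>lborel) * ennreal c)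
    = ennreal \<bar>det T\<bar> * ennreal (c / \<bar>det T\<bar>) * (\<integral>\<^sup>+y. f y \<partial>lborel)"
    unfolding g gT by (simp add: mult.assoc)
  also have "ennreal \<bar>det T\<bar> * ennreal (c / \<bar>det T\<bar>) = ennreal c"
    using T by (subst ennreal_mult[symmetric]) (auto simp: invertible_det_nz cpos less_imp_le)
  finally have "(ennreal \<bar>det T\<bar> * (\<integral>\<^sup>+x. f (T *v x) \<partial>lborel)) * ennreal c
      = (\<integral>\<^sup>+y. f y \<partial>lborel) * ennreal c"
    by (simp add: mult_ac)
  then show ?thesis by (rule ennreal_mult_ennreal_cancel[OF cpos])
qed

section \<open>Gaussians as affine images of the standard Gaussian\<close>

definition std_gaussian :: "(real ^ 'n) measure" where
  "std_gaussian = density lborel (\<lambda>x. \<Prod>i\<in>UNIV. ennreal (std_normal_density (x $ i)))"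

lemma sets_std_gaussian [measurable_cong, simp]: "sets std_gaussian = sets borel"
  by (simp add: std_gaussian_def)

lemma space_std_gaussian [simp]: "space std_gaussian = UNIV"
  by (simp add: std_gaussian_def)

lemma sets_gaussian [measurable_cong, simp]: "sets (gaussian m S) = sets borel"
  by (simp add: gaussian_def)

lemma space_gaussian [simp]: "space (gaussian m S) = UNIV"
  by (simp add: gaussian_def)

lemma std_normal_density_prod_eq:
  "(\<Prod>i\<in>UNIV. std_normal_density (x $ i)) =
    (1 / sqrt (2 * pi)) ^ CARD('n) * exp (- (norm x)\<^sup>2 / 2)" for x :: "real ^ 'n"
proof -
  have "(norm x)\<^sup>2 = (\<Sum>i\<in>UNIV. (x $ i)\<^sup>2)"
    unfolding power2_norm_eq_inner by (simp add: inner_vec_def power2_eq_square)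
  then have "exp (- (norm x)\<^sup>2 / 2) = (\<Prod>i\<in>UNIV. exp (- (x $ i)\<^sup>2 / 2))"
    by (simp add: exp_sum[symmetric] sum_divide_distrib sum_negf)
  then show ?thesis
    unfolding std_normal_density_def prod.distrib by simp
qed

lemma gaussian_density_affine:
  fixes T :: "real ^ 'n ^ 'n"
  assumes T: "T ** T' = mat 1"
  shows "gaussian_density m (T ** transpose T) x =
    (1 / sqrt (2 * pi)) ^ CARD('n) / \<bar>det T\<bar> * exp (- (norm (T' *v (x - m)))\<^sup>2 / 2)"
proof -
  have T2: "T' ** T = mat 1" using T matrix_left_right_inverse by blast
  have "T ** transpose T ** (transpose T' ** T') = T ** transpose (T' ** T) ** T'"
    by (simp add: matrix_transpose_mul matrix_mul_assoc)
  then have "matrix_inv (T ** transpose T) = transpose T' ** T'"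
    by (intro matrix_inv_eqI) (simp add: T T2)
  then have "(x - m) \<bullet> (matrix_inv (T ** transpose T) *v (x - m)) = (norm (T' *v (x - m)))\<^sup>2"
    unfolding power2_norm_eq_inner by (metis inner_transpose_mult matrix_vector_mul_assoc)
  moreover have "det ((2 * pi) *\<^sub>R (T ** transpose T)) powr (- 1 / 2)
      = (1 / sqrt (2 * pi)) ^ CARD('n) / \<bar>det T\<bar>"
  proof -
    have "(2 * pi) *\<^sub>R (T ** transpose T) = diagm (\<lambda>_. 2 * pi) ** (T ** transpose T)"
      by (simp add: vec_eq_iff matrix_matrix_mult_def[of "diagm _"] if_distrib[where f="\<lambda>x. x * _"] cong: if_cong)
    then have d: "det ((2 * pi) *\<^sub>R (T ** transpose T)) = (2 * pi) ^ CARD('n) * (det T)\<^sup>2"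
      by (simp add: det_mul det_diagm power2_eq_square)
    have "det T * det T' = 1" using T by (metis det_mul det_I)
    then have "det T \<noteq> 0" by auto
    then have "0 < (2 * pi) ^ CARD('n) * (det T)\<^sup>2" by simp
    moreover have "X powr (- 1 / 2) = 1 / sqrt X" if "0 < X" for X :: real
      using powr_minus_divide[of X "1 / 2"] powr_half_sqrt[of X] that by simp
    ultimately have "((2 * pi) ^ CARD('n) * (det T)\<^sup>2) powr (- 1 / 2) = 1 / sqrt ((2 * pi) ^ CARD('n) * (det T)\<^sup>2)"
      by blast
    also have "sqrt ((2 * pi) ^ CARD('n) * (det T)\<^sup>2) = sqrt ((2 * pi) ^ CARD('n)) * sqrt ((det T)\<^sup>2)"
      by (rule real_sqrt_mult)
    also have "\<dots> = sqrt (2 * pi) ^ CARD('n) * \<bar>det T\<bar>"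
      by (subst real_sqrt_power) simp
    also have "1 / (sqrt (2 * pi) ^ CARD('n) * \<bar>det T\<bar>) = (1 / sqrt (2 * pi)) ^ CARD('n) / \<bar>det T\<bar>"
      by (simp only: power_one_over divide_divide_eq_left)
    finally show ?thesis unfolding d .
  qed
  ultimately show ?thesis by (simp add: gaussian_density_def)
qed

lemma borel_measurable_gaussian_density [measurable]: "gaussian_density m S \<in> borel_measurable borel"
  unfolding gaussian_density_def[abs_def] by measurable

text \<open>This yields both the total mass 1 of a Gaussian and the passage to standard coordinates.
  Any invertible factor \<open>T\<close> is allowed, so the factor can be adapted to both
  covariances at once.\<close>

theorem gaussian_eq_distr_std_gaussian:
  fixes T :: "real ^ 'n ^ 'n"
  assumes T: "invertible T"
  shows "gaussian m (T ** transpose T) = distr std_gaussian borel (\<lambda>y. m + T *v y)"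
proof (rule measure_eqI)
  fix A assume "A \<in> sets (gaussian m (T ** transpose T))"
  then have [measurable]: "A \<in> sets borel" by simp
  obtain T' where T': "T ** T' = mat 1" "T' ** T = mat 1" using T unfolding invertible_def by blast
  let ?q = "gaussian_density m (T ** transpose T)"
  have q: "\<bar>det T\<bar> * ?q (m + T *v y) = (\<Prod>i\<in>UNIV. std_normal_density (y $ i))" for y
    using T by (simp add: gaussian_density_affine[OF T'(1)] std_normal_density_prod_eq
        matrix_vector_mul_assoc T' invertible_det_nz)
  have "emeasure (gaussian m (T ** transpose T)) A = (\<integral>\<^sup>+x. ennreal (?q x) * indicator A x \<partial>lborel)"
    by (simp add: gaussian_def emeasure_density)
  also have "\<dots> = (\<integral>\<^sup>+x. ennreal (?q (m + x)) * indicator A (m + x) \<partial>lborel)"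
    using nn_integral_lborel_translation[of "\<lambda>x. ennreal (?q x) * indicator A x" 1 m] by simp
  also have "\<dots> = ennreal \<bar>det T\<bar> * (\<integral>\<^sup>+y. ennreal (?q (m + T *v y)) * indicator A (m + T *v y) \<partial>lborel)"
    by (rule nn_integral_lborel_linear[OF _ T, symmetric]) simp
  also have "\<dots> = (\<integral>\<^sup>+y. ennreal (\<bar>det T\<bar> * ?q (m + T *v y)) * indicator A (m + T *v y) \<partial>lborel)"
    by (subst nn_integral_cmult[symmetric]) (auto simp: ennreal_mult' mult.assoc)
  also have "\<dots> = emeasure (distr std_gaussian borel (\<lambda>y. m + T *v y)) A"
    unfolding q by (simp add: std_gaussian_def emeasure_distr emeasure_density prod_ennreal
        indicator_def of_bool_def vimage_def)
  finally show "emeasure (gaussian m (T ** transpose T)) A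
    = emeasure (distr std_gaussian borel (\<lambda>y. m + T *v y)) A" .
qed simp

section \<open>Marginals and independence of the coordinates\<close>

abbreviation std_normal :: "real measure" where
  "std_normal \<equiv> density lborel (\<lambda>x. ennreal (std_normal_density x))"

lemma prob_space_std_normal: "prob_space std_normal"
  by (rule prob_space_normal_density) simp

lemma emeasure_std_gaussian_box:
  fixes A :: "'n::finite \<Rightarrow> real set"
  assumes [measurable]: "\<And>i. A i \<in> sets borel"
  shows "emeasure std_gaussian {x. \<forall>i. x $ i \<in> A i} = (\<Prod>i\<in>UNIV. emeasure std_normal (A i))"
proof -
  have [measurable]: "{x :: real ^ 'n. \<forall>i. x $ i \<in> A i} \<in> sets borel" by measurable
  have "indicator {x :: real ^ 'n. \<forall>i. x $ i \<in> A i} x = (\<Prod>i\<in>UNIV. indicator (A i) (x $ i) :: ennreal)" for x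
    by (auto simp: indicator_def)
  then have "emeasure std_gaussian {x. \<forall>i. x $ i \<in> A i}
    = (\<integral>\<^sup>+x. (\<Prod>i\<in>UNIV. ennreal (std_normal_density (x $ i)) * indicator (A i) (x $ i)) \<partial>lborel)"
    by (simp add: std_gaussian_def emeasure_density prod.distrib)
  also have "\<dots> = (\<Prod>i\<in>UNIV. \<integral>\<^sup>+x. ennreal (std_normal_density x) * indicator (A i) x \<partial>lborel)"
    by (rule nn_integral_lborel_vec_prod) simp
  finally show ?thesis by (simp add: emeasure_density)
qed

lemma prob_space_std_gaussian: "prob_space (std_gaussian :: (real ^ 'n) measure)"
proof
  interpret N: prob_space std_normal by (rule prob_space_std_normal)
  show "emeasure std_gaussian (space std_gaussian :: (real ^ 'n) set) = 1"
    using emeasure_std_gaussian_box[of "\<lambda>i::'n. UNIV"] N.emeasure_space_1 by simp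
qed

lemma distr_std_gaussian_nth: "distr std_gaussian borel (\<lambda>x. x $ i) = std_normal"
proof (rule measure_eqI)
  interpret N: prob_space std_normal by (rule prob_space_std_normal)
  have U: "emeasure std_normal UNIV = 1" using N.emeasure_space_1 by simp
  fix A assume "A \<in> sets (distr std_gaussian borel (\<lambda>x. x $ i))"
  then have [measurable]: "A \<in> sets borel" by simp
  have "emeasure (distr std_gaussian borel (\<lambda>x. x $ i)) A
      = emeasure std_gaussian {x. \<forall>j. x $ j \<in> (if j = i then A else UNIV)}"
    by (subst emeasure_distr) (auto intro!: arg_cong[where f="emeasure std_gaussian"])
  also have "\<dots> = (\<Prod>j\<in>UNIV. emeasure std_normal (if j = i then A else UNIV))"
    by (rule emeasure_std_gaussian_box) simp
  also have "\<dots> = (\<Prod>j\<in>UNIV. if j = i then emeasure std_normal A else 1)"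
    by (intro prod.cong) (auto simp: U)
  finally show "emeasure (distr std_gaussian borel (\<lambda>x. x $ i)) A = emeasure std_normal A"
    by simp
qed simp

text \<open>Independence means that the joint law is the product of the marginals, and a product
  measure is determined by its values on boxes.\<close>

lemma indep_vars_std_gaussian:
  "prob_space.indep_vars (std_gaussian :: (real ^ 'n) measure) (\<lambda>_. borel) (\<lambda>i x. x $ i) UNIV"
proof -
  interpret G: prob_space "std_gaussian :: (real ^ 'n) measure" by (rule prob_space_std_gaussian)
  interpret N: prob_space std_normal by (rule prob_space_std_normal)
  interpret P: product_sigma_finite "\<lambda>_::'n. std_normal"
    by unfold_locales
  have "distr std_gaussian (\<Pi>\<^sub>M i\<in>UNIV. borel) (\<lambda>x. \<lambda>i\<in>UNIV. (x::real ^ 'n) $ i)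
      = (\<Pi>\<^sub>M i\<in>UNIV. std_normal)"
  proof (rule P.PiM_eqI)
    fix A :: "'n \<Rightarrow> real set" assume "\<And>i. i \<in> UNIV \<Longrightarrow> A i \<in> sets std_normal"
    then have [measurable]: "\<And>i. A i \<in> sets borel" by simp
    have "emeasure (distr std_gaussian (\<Pi>\<^sub>M i\<in>UNIV. borel) (\<lambda>x. \<lambda>i\<in>UNIV. (x::real ^ 'n) $ i)) (Pi\<^sub>E UNIV A)
        = emeasure std_gaussian {x. \<forall>i. x $ i \<in> A i}"
      by (subst emeasure_distr) (auto intro!: arg_cong[where f="emeasure std_gaussian"] sets_PiM_I_finite)
    then show "emeasure (distr std_gaussian (\<Pi>\<^sub>M i\<in>UNIV. borel) (\<lambda>x. \<lambda>i\<in>UNIV. (x::real ^ 'n) $ i)) (Pi\<^sub>E UNIV A)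
        = (\<Prod>i\<in>UNIV. emeasure std_normal (A i))"
      by (simp add: emeasure_std_gaussian_box)
  qed (auto intro!: sets_PiM_cong)
  then show ?thesis
    by (subst G.indep_vars_iff_distr_eq_PiM') (auto simp: distr_std_gaussian_nth)
qed

section \<open>Lower bound from second and fourth moments\<close>

lemma integrable_power_le_4:
  fixes X :: "'a \<Rightarrow> real"
  assumes "finite_measure M" and X [measurable]: "X \<in> borel_measurable M"
    and int: "integrable M (\<lambda>x. X x ^ 4)" and k: "k \<le> 4"
  shows "integrable M (\<lambda>x. X x ^ k)"
proof (rule Bochner_Integration.integrable_bound)
  interpret finite_measure M by fact
  show "integrable M (\<lambda>x. 1 + X x ^ 4)" using int by simp
  have "\<bar>a\<bar> ^ k \<le> 1 + \<bar>a\<bar> ^ 4" for a :: real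
  proof (cases "\<bar>a\<bar> \<le> 1")
    case True
    then have "\<bar>a\<bar> ^ k \<le> 1" by (simp add: power_le_one)
    moreover have "0 \<le> \<bar>a\<bar> ^ 4" by simp
    ultimately show ?thesis by linarith
  next
    case False
    then have "\<bar>a\<bar> ^ k \<le> \<bar>a\<bar> ^ 4" using k by (intro power_increasing) auto
    then show ?thesis by simp
  qed
  then show "AE x in M. norm (X x ^ k) \<le> norm (1 + X x ^ 4)"
    by (simp add: power_abs)
qed simp

text \<open>Terms with an odd mixed power contain a mean and vanish, leaving
  \<open>6 * (a * b)\<close> between the fourth moments, while \<open>15 * (a + b)\<^sup>2\<close>
  provides \<open>30 * (a * b)\<close>. The value 15 is dictated by a single summand: it is the
  kurtosis of the square of a standard normal variable.\<close>

lemma (in prob_space) fourth_moment_add: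
  fixes X Y :: "'a \<Rightarrow> real"
  assumes ind: "indep_var borel X borel Y"
    and intX: "integrable M (\<lambda>x. X x ^ 4)" and intY: "integrable M (\<lambda>x. Y x ^ 4)"
    and meanX: "expectation X = 0" and meanY: "expectation Y = 0"
    and X4: "expectation (\<lambda>x. X x ^ 4) \<le> 15 * (expectation (\<lambda>x. (X x)\<^sup>2))\<^sup>2"
    and Y4: "expectation (\<lambda>x. Y x ^ 4) \<le> 15 * (expectation (\<lambda>x. (Y x)\<^sup>2))\<^sup>2"
  shows "integrable M (\<lambda>x. (X x + Y x) ^ 4)"
    and "expectation (\<lambda>x. X x + Y x) = 0"
    and "expectation (\<lambda>x. (X x + Y x)\<^sup>2) = expectation (\<lambda>x. (X x)\<^sup>2) + expectation (\<lambda>x. (Y x)\<^sup>2)"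
    and "expectation (\<lambda>x. (X x + Y x) ^ 4) \<le> 15 * (expectation (\<lambda>x. (X x + Y x)\<^sup>2))\<^sup>2"
proof -
  have [measurable]: "random_variable borel X" "random_variable borel Y"
    using ind by (auto dest: indep_var_rv1 indep_var_rv2)
  have iX: "integrable M (\<lambda>x. X x ^ k)" and iY: "integrable M (\<lambda>x. Y x ^ k)" if "k \<le> 4" for k
    using integrable_power_le_4[OF finite_measure_axioms _ intX that]
      integrable_power_le_4[OF finite_measure_axioms _ intY that] by auto
  have iXY: "integrable M (\<lambda>x. X x ^ j * Y x ^ k)"
    and eXY: "expectation (\<lambda>x. X x ^ j * Y x ^ k) = expectation (\<lambda>x. X x ^ j) * expectation (\<lambda>x. Y x ^ k)"
    if "j \<le> 4" "k \<le> 4" for j k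
  proof -
    have "indep_var borel ((\<lambda>x. x ^ j) \<circ> X) borel ((\<lambda>x. x ^ k) \<circ> Y)"
      by (rule indep_var_compose[OF ind]) auto
    then have *: "indep_var borel (\<lambda>x. X x ^ j) borel (\<lambda>x. Y x ^ k)" by (simp add: comp_def)
    show "integrable M (\<lambda>x. X x ^ j * Y x ^ k)"
      using that by (intro indep_var_integrable * iX iY)
    show "expectation (\<lambda>x. X x ^ j * Y x ^ k) = expectation (\<lambda>x. X x ^ j) * expectation (\<lambda>x. Y x ^ k)"
      using that by (intro indep_var_lebesgue_integral * iX iY)
  qed
  have e4: "(X x + Y x) ^ 4 = X x ^ 4 + 4 * (X x ^ 3 * Y x ^ 1) + 6 * (X x ^ 2 * Y x ^ 2)
      + 4 * (X x ^ 1 * Y x ^ 3) + Y x ^ 4" for x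
    by (simp add: power4_eq_xxxx power3_eq_cube power2_eq_square algebra_simps)
  have e2: "(X x + Y x)\<^sup>2 = (X x)\<^sup>2 + 2 * (X x ^ 1 * Y x ^ 1) + (Y x)\<^sup>2" for x
    by (simp add: power2_eq_square algebra_simps)
  show "integrable M (\<lambda>x. (X x + Y x) ^ 4)"
    unfolding e4 by (intro Bochner_Integration.integrable_add integrable_mult_right iXY intX intY) auto
  show "expectation (\<lambda>x. X x + Y x) = 0"
    using iX[of 1] iY[of 1] meanX meanY by simp
  show V: "expectation (\<lambda>x. (X x + Y x)\<^sup>2) = expectation (\<lambda>x. (X x)\<^sup>2) + expectation (\<lambda>x. (Y x)\<^sup>2)"
  proof -
    have "expectation (\<lambda>x. (X x + Y x)\<^sup>2) = expectation (\<lambda>x. (X x)\<^sup>2)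
      + 2 * expectation (\<lambda>x. X x ^ 1 * Y x ^ 1) + expectation (\<lambda>x. (Y x)\<^sup>2)"
      unfolding e2 using iX[of 2] iY[of 2] iXY[of 1 1] by simp
    then show ?thesis using eXY[of 1 1] meanX by simp
  qed
  define a b where "a = expectation (\<lambda>x. (X x)\<^sup>2)" and "b = expectation (\<lambda>x. (Y x)\<^sup>2)"
  have "expectation (\<lambda>x. (X x + Y x) ^ 4) = expectation (\<lambda>x. X x ^ 4)
      + 4 * expectation (\<lambda>x. X x ^ 3 * Y x ^ 1) + 6 * expectation (\<lambda>x. X x ^ 2 * Y x ^ 2)
      + 4 * expectation (\<lambda>x. X x ^ 1 * Y x ^ 3) + expectation (\<lambda>x. Y x ^ 4)"
    unfolding e4 using intX intY iXY[of 3 1] iXY[of 2 2] iXY[of 1 3] by simp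
  also have "\<dots> = expectation (\<lambda>x. X x ^ 4) + 6 * (a * b) + expectation (\<lambda>x. Y x ^ 4)"
    using eXY[of 3 1] eXY[of 1 3] eXY[of 2 2] meanX meanY by (simp add: a_def b_def)
  also have "\<dots> \<le> 15 * a\<^sup>2 + 6 * (a * b) + 15 * b\<^sup>2"
    using X4 Y4 by (simp add: a_def b_def)
  also have "\<dots> \<le> 15 * (a + b)\<^sup>2"
  proof -
    have "0 \<le> a * b" unfolding a_def b_def by simp
    then show ?thesis by (simp add: power2_sum algebra_simps)
  qed
  finally show "expectation (\<lambda>x. (X x + Y x) ^ 4) \<le> 15 * (expectation (\<lambda>x. (X x + Y x)\<^sup>2))\<^sup>2"
    unfolding V a_def b_def .
qed

lemma (in prob_space) fourth_moment_sum:
  fixes Z :: "'i \<Rightarrow> 'a \<Rightarrow> real"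
  assumes "finite I" and "indep_vars (\<lambda>_. borel) Z I"
    and "\<And>i. i \<in> I \<Longrightarrow> integrable M (\<lambda>x. Z i x ^ 4)"
    and "\<And>i. i \<in> I \<Longrightarrow> expectation (Z i) = 0"
    and "\<And>i. i \<in> I \<Longrightarrow> expectation (\<lambda>x. Z i x ^ 4) \<le> 15 * (expectation (\<lambda>x. (Z i x)\<^sup>2))\<^sup>2"
  shows "integrable M (\<lambda>x. (\<Sum>i\<in>I. Z i x) ^ 4) \<and> expectation (\<lambda>x. \<Sum>i\<in>I. Z i x) = 0
    \<and> expectation (\<lambda>x. (\<Sum>i\<in>I. Z i x)\<^sup>2) = (\<Sum>i\<in>I. expectation (\<lambda>x. (Z i x)\<^sup>2))
    \<and> expectation (\<lambda>x. (\<Sum>i\<in>I. Z i x) ^ 4) \<le> 15 * (expectation (\<lambda>x. (\<Sum>i\<in>I. Z i x)\<^sup>2))\<^sup>2"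
  using assms
proof (induction I)
  case (insert i I)
  have "indep_vars (\<lambda>_. borel) Z I" using insert.prems(1) by (rule indep_vars_subset) auto
  with insert have IH: "integrable M (\<lambda>x. (\<Sum>i\<in>I. Z i x) ^ 4)" "expectation (\<lambda>x. \<Sum>i\<in>I. Z i x) = 0"
    "expectation (\<lambda>x. (\<Sum>i\<in>I. Z i x)\<^sup>2) = (\<Sum>i\<in>I. expectation (\<lambda>x. (Z i x)\<^sup>2))"
    "expectation (\<lambda>x. (\<Sum>i\<in>I. Z i x) ^ 4) \<le> 15 * (expectation (\<lambda>x. (\<Sum>i\<in>I. Z i x)\<^sup>2))\<^sup>2"
    by auto
  have "indep_var borel (Z i) borel (\<lambda>x. \<Sum>i\<in>I. Z i x)"
    using insert by (intro indep_vars_sum) auto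
  note add = fourth_moment_add[OF this insert.prems(2) IH(1) insert.prems(3) IH(2)
      insert.prems(4) IH(4), simplified]
  show ?case using add IH(3) insert.hyps by simp
qed auto

text \<open>The third moment need not vanish, so the cross term \<open>4 * c * X x ^ 3\<close> is
  absorbed pointwise into the neighbouring even powers. This doubles the coefficient of the fourth
  moment and turns 15 into 30.\<close>

lemma (in prob_space) shifted_fourth_moment:
  fixes X :: "'a \<Rightarrow> real"
  assumes [measurable]: "random_variable borel X" and int: "integrable M (\<lambda>x. X x ^ 4)"
    and mean: "expectation X = 0"
    and X4: "expectation (\<lambda>x. X x ^ 4) \<le> 15 * (expectation (\<lambda>x. (X x)\<^sup>2))\<^sup>2"
  shows "integrable M (\<lambda>x. (X x + c) ^ 4)"
    and "expectation (\<lambda>x. (X x + c)\<^sup>2) = expectation (\<lambda>x. (X x)\<^sup>2) + c\<^sup>2"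
    and "expectation (\<lambda>x. (X x + c) ^ 4) \<le> 30 * (expectation (\<lambda>x. (X x + c)\<^sup>2))\<^sup>2"
proof -
  have i: "integrable M (\<lambda>x. X x ^ k)" if "k \<le> 4" for k
    using integrable_power_le_4[OF finite_measure_axioms _ int that] by auto
  have e4: "(X x + c) ^ 4 = X x ^ 4 + 4 * c * X x ^ 3 + 6 * c\<^sup>2 * X x ^ 2 + 4 * c ^ 3 * X x ^ 1 + c ^ 4" for x
    by (simp add: power4_eq_xxxx power3_eq_cube power2_eq_square algebra_simps)
  show int': "integrable M (\<lambda>x. (X x + c) ^ 4)"
    unfolding e4 by (intro Bochner_Integration.integrable_add integrable_mult_right i) auto
  have "expectation (\<lambda>x. (X x + c)\<^sup>2) = expectation (\<lambda>x. (X x)\<^sup>2 + 2 * c * X x ^ 1 + c\<^sup>2)"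
    by (intro Bochner_Integration.integral_cong) (auto simp: power2_sum)
  also have "\<dots> = expectation (\<lambda>x. (X x)\<^sup>2) + c\<^sup>2"
    using i[of 2] i[of 1] mean by (simp add: prob_space)
  finally show V: "expectation (\<lambda>x. (X x + c)\<^sup>2) = expectation (\<lambda>x. (X x)\<^sup>2) + c\<^sup>2" .
  define a where "a = expectation (\<lambda>x. (X x)\<^sup>2)"
  have pt: "(x + c) ^ 4 \<le> 2 * x ^ 4 + 10 * c\<^sup>2 * x ^ 2 + 4 * c ^ 3 * x ^ 1 + c ^ 4" for x :: real
  proof -
    have "2 * x ^ 4 + 10 * c\<^sup>2 * x ^ 2 + 4 * c ^ 3 * x ^ 1 + c ^ 4 - (x + c) ^ 4 = (x\<^sup>2 - 2 * c * x)\<^sup>2"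
      by (simp add: power4_eq_xxxx power3_eq_cube power2_eq_square algebra_simps)
    then show ?thesis by (metis diff_ge_0_iff_ge zero_le_power2)
  qed
  have "expectation (\<lambda>x. (X x + c) ^ 4)
      \<le> expectation (\<lambda>x. 2 * X x ^ 4 + 10 * c\<^sup>2 * X x ^ 2 + 4 * c ^ 3 * X x ^ 1 + c ^ 4)"
    using int' i[of 4] i[of 2] i[of 1] by (intro integral_mono pt) simp_all
  also have "\<dots> = 2 * expectation (\<lambda>x. X x ^ 4) + 10 * c\<^sup>2 * a + c ^ 4"
    using i[of 4] i[of 2] i[of 1] mean by (simp add: prob_space a_def)
  also have "\<dots> \<le> 30 * a\<^sup>2 + 10 * c\<^sup>2 * a + c ^ 4" using X4 by (simp add: a_def)
  also have "\<dots> \<le> 30 * (a + c\<^sup>2)\<^sup>2"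
  proof -
    have "0 \<le> c\<^sup>2 * a" "0 \<le> c ^ 4" unfolding a_def by auto
    then show ?thesis by (simp add: power2_sum algebra_simps flip: power_mult)
  qed
  finally show "expectation (\<lambda>x. (X x + c) ^ 4) \<le> 30 * (expectation (\<lambda>x. (X x + c)\<^sup>2))\<^sup>2"
    unfolding V a_def .
qed

text \<open>The quartic on the left has expectation at least \<open>t / 20\<close> when \<open>s\<close> is the root mean
  square of \<open>h\<close> and \<open>E h\<^sup>4 \<le> 30 * s\<^sup>4\<close>; this fixes its coefficients.\<close>

lemma quotient_ge_quartic:
  fixes h s t :: real
  assumes t: "0 < t" "t\<^sup>2 \<le> 4 / 25" and s: "t \<le> s"
  shows "t * ((h / s)\<^sup>2 / 10 - (h / s) ^ 4 / 600) \<le> \<bar>h\<bar> / (1 + \<bar>h\<bar>)"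
proof -
  define u where "u = \<bar>h\<bar> / s"
  have u: "0 \<le> u" using assms by (simp add: u_def)
  have hu: "\<bar>h\<bar> = s * u" using assms by (simp add: u_def)
  have t2: "t \<le> 2 / 5" using t by (intro power2_le_imp_le[of t "2/5"]) (auto simp: power_divide)
  \<comment> \<open>A sum-of-squares certificate: completing the square in the quartic leaves a
    quadratic that is again a square plus a positive constant. The 2/5 is the largest admissible
    \<open>t\<close>.\<close>
  have "300 * (10 - (u - u ^ 3 / 60) * (1 + 2 / 5 * u))
      = 2 * (u\<^sup>2 + 5 / 4 * u - 34)\<^sup>2 + 103 / 8 * (u - 520 / 103)\<^sup>2 + 37064 / 103"
    by (simp add: power3_eq_cube power2_eq_square field_simps)
  also have "\<dots> \<ge> 0" by simp
  finally have poly: "(u - u ^ 3 / 60) * (1 + 2 / 5 * u) \<le> 10"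
    unfolding zero_le_mult_iff by auto
  have "u\<^sup>2 / 10 - u ^ 4 / 600 = u / 10 * (u - u ^ 3 / 60)"
    by (simp add: power4_eq_xxxx power3_eq_cube power2_eq_square algebra_simps)
  also have "\<dots> \<le> u / 10 * (10 / (1 + 2 / 5 * u))"
  proof (rule mult_left_mono)
    show "u - u ^ 3 / 60 \<le> 10 / (1 + 2 / 5 * u)"
      by (subst pos_le_divide_eq) (use u poly in auto)
  qed (use u in simp)
  also have "\<dots> = u / (1 + 2 / 5 * u)" by simp
  also have "\<dots> \<le> u / (1 + t * u)"
  proof -
    have "t * u \<le> 2 / 5 * u" using t2 u by (rule mult_right_mono)
    moreover have "0 \<le> t * u" using t u by simp
    ultimately show ?thesis using u by (intro divide_left_mono) auto
  qed
  finally have "t * (u\<^sup>2 / 10 - u ^ 4 / 600) \<le> t * (u / (1 + t * u))"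
    using t by (intro mult_left_mono) auto
  also have "\<dots> = t * u / (1 + t * u)" by simp
  \<comment> \<open>\<open>x / (1 + x)\<close> increases with \<open>x\<close>. Passing from
    \<open>s\<close> to \<open>t\<close> here is what lets the root mean square \<open>s\<close> be
    arbitrarily large.\<close>
  also have "\<dots> \<le> s * u / (1 + s * u)"
  proof -
    have "t * u \<le> s * u" using s u by (rule mult_right_mono)
    moreover have "0 \<le> t * u" using t u by simp
    ultimately show ?thesis by (simp add: divide_simps) (simp add: algebra_simps)
  qed
  finally have "t * (u\<^sup>2 / 10 - u ^ 4 / 600) \<le> \<bar>h\<bar> / (1 + \<bar>h\<bar>)" by (simp add: hu)
  moreover have "u\<^sup>2 = (h / s)\<^sup>2" "u ^ 4 = (h / s) ^ 4" by (auto simp: u_def power_divide)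
  ultimately show ?thesis by simp
qed

text \<open>Both signs follow from \<open>exp x \<ge> 1 + x\<close>, taken at \<open>h\<close> or at
  \<open>- h\<close>.\<close>

lemma quotient_le_abs_one_minus_exp: "\<bar>h\<bar> / (1 + \<bar>h\<bar>) \<le> \<bar>1 - exp (- h)\<bar>" for h :: real
proof (cases "0 \<le> h")
  case True
  have "exp (- h) \<le> 1 / (1 + h)"
    using exp_ge_add_one_self[of h] True by (simp add: exp_minus field_simps)
  then show ?thesis using True by (simp add: field_simps)
next
  case False
  have "\<bar>h\<bar> / (1 + \<bar>h\<bar>) \<le> \<bar>h\<bar>" by (simp add: field_simps)
  also have "\<dots> \<le> exp (- h) - 1" using False exp_ge_add_one_self[of "- h"] by simp
  finally show ?thesis by simp
qed

text \<open>Here \<open>t\<close> plays the role of the root mean square of \<open>h\<close> capped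
  at 2/5: the left side of the conclusion must stay bounded, since total variation
  saturates.\<close>

lemma (in prob_space) expectation_abs_one_minus_exp_ge:
  fixes h :: "'a \<Rightarrow> real"
  assumes [measurable]: "random_variable borel h" and int: "integrable M (\<lambda>x. h x ^ 4)"
    and h4: "expectation (\<lambda>x. h x ^ 4) \<le> 30 * (expectation (\<lambda>x. (h x)\<^sup>2))\<^sup>2"
    and t: "0 < t" "t\<^sup>2 \<le> 4 / 25" "t\<^sup>2 \<le> expectation (\<lambda>x. (h x)\<^sup>2)"
    and inte: "integrable M (\<lambda>x. 1 - exp (- h x))"
  shows "t / 20 \<le> expectation (\<lambda>x. \<bar>1 - exp (- h x)\<bar>)"
proof -
  define s where "s = sqrt (expectation (\<lambda>x. (h x)\<^sup>2))"
  have ts: "t \<le> s" unfolding s_def using t by (intro real_le_rsqrt)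
  then have s: "0 < s" using t by simp
  have s2: "s\<^sup>2 = expectation (\<lambda>x. (h x)\<^sup>2)" by (simp add: s_def)
  have i2: "integrable M (\<lambda>x. (h x)\<^sup>2)"
    using integrable_power_le_4[OF finite_measure_axioms _ int, of 2] by simp
  have "t / 20 = t * (1 / 10 - 30 / 600)" by simp
  also have "\<dots> \<le> t * (expectation (\<lambda>x. (h x)\<^sup>2) / s\<^sup>2 / 10 - expectation (\<lambda>x. h x ^ 4) / s ^ 4 / 600)"
  proof -
    have "s ^ 4 = (expectation (\<lambda>x. (h x)\<^sup>2))\<^sup>2" by (simp flip: s2 power_mult)
    then have "expectation (\<lambda>x. h x ^ 4) / s ^ 4 \<le> 30" using h4 s by (subst pos_divide_le_eq) auto
    moreover have "expectation (\<lambda>x. (h x)\<^sup>2) / s\<^sup>2 = 1" using s unfolding s2[symmetric] by simp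
    moreover have "1 / 10 - 30 / 600 \<le> y / 10 - x / 600" if "x \<le> 30" "y = 1" for x y :: real
      using that by simp
    ultimately have "1 / 10 - 30 / 600 \<le> expectation (\<lambda>x. (h x)\<^sup>2) / s\<^sup>2 / 10 - expectation (\<lambda>x. h x ^ 4) / s ^ 4 / 600"
      by blast
    then show ?thesis using t by (intro mult_left_mono) auto
  qed
  also have "\<dots> = expectation (\<lambda>x. t * ((h x / s)\<^sup>2 / 10 - (h x / s) ^ 4 / 600))"
    using int i2 by (simp add: power_divide)
  also have "\<dots> \<le> expectation (\<lambda>x. \<bar>1 - exp (- h x)\<bar>)"
  proof (rule integral_mono)
    show "integrable M (\<lambda>x. t * ((h x / s)\<^sup>2 / 10 - (h x / s) ^ 4 / 600))"
      using int i2 by (simp add: power_divide)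
    show "integrable M (\<lambda>x. \<bar>1 - exp (- h x)\<bar>)" using inte by simp
    show "t * ((h x / s)\<^sup>2 / 10 - (h x / s) ^ 4 / 600) \<le> \<bar>1 - exp (- h x)\<bar>" for x
      using quotient_ge_quartic[OF t(1,2) ts, of "h x"] quotient_le_abs_one_minus_exp[of "h x"] by linarith
  qed
  finally show ?thesis .
qed

section \<open>Moments of quadratic polynomials in Gaussian coordinates\<close>

lemma has_bochner_integral_std_normal_power:
  "has_bochner_integral std_normal (\<lambda>x. x ^ (2 * k)) (fact (2 * k) / (2 ^ k * fact k))"
  "has_bochner_integral std_normal (\<lambda>x. x ^ (2 * k + 1)) 0"
  by (rule has_bochner_integral_density;
      use std_normal_moment_even[of k] std_normal_moment_odd[of k] in simp)+

lemma std_normal_moments: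
  "has_bochner_integral std_normal (\<lambda>x. x ^ 1) 0"
  "has_bochner_integral std_normal (\<lambda>x. x ^ 2) 1"
  "has_bochner_integral std_normal (\<lambda>x. x ^ 3) 0"
  "has_bochner_integral std_normal (\<lambda>x. x ^ 4) 3"
  "has_bochner_integral std_normal (\<lambda>x. x ^ 5) 0"
  "has_bochner_integral std_normal (\<lambda>x. x ^ 6) 15"
  "has_bochner_integral std_normal (\<lambda>x. x ^ 7) 0"
  "has_bochner_integral std_normal (\<lambda>x. x ^ 8) 105"
  using has_bochner_integral_std_normal_power(2)[of 0] has_bochner_integral_std_normal_power(1)[of 1]
    has_bochner_integral_std_normal_power(2)[of 1] has_bochner_integral_std_normal_power(1)[of 2]
    has_bochner_integral_std_normal_power(2)[of 2] has_bochner_integral_std_normal_power(1)[of 3]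
    has_bochner_integral_std_normal_power(2)[of 3] has_bochner_integral_std_normal_power(1)[of 4]
  by (simp_all add: fact_numeral)

text \<open>The polynomials \<open>x\<^sup>2 - 1\<close> and \<open>x\<close> are the Hermite
  polynomials of degree 2 and 1; their orthogonality is why the variance has no \<open>a * b\<close>
  term. The fourth moment differs from 15 times the squared variance only in the coefficient of
  \<open>b ^ 4\<close>, 3 instead of 15.\<close>

lemma std_normal_quadratic_moments:
  fixes a b :: real
  defines "p \<equiv> \<lambda>x. a * (x\<^sup>2 - 1) + b * x"
  shows "has_bochner_integral std_normal p 0"
    and "has_bochner_integral std_normal (\<lambda>x. (p x)\<^sup>2) (2 * a\<^sup>2 + b\<^sup>2)"
    and "has_bochner_integral std_normal (\<lambda>x. p x ^ 4) (60 * a ^ 4 + 60 * a\<^sup>2 * b\<^sup>2 + 3 * b ^ 4)"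
proof -
  interpret N: prob_space std_normal by (rule prob_space_std_normal)
  have m0: "has_bochner_integral std_normal (\<lambda>x. c) c" for c :: real
    using N.prob_space by (auto simp: has_bochner_integral_iff)
  note m = std_normal_moments
  note add = has_bochner_integral_add and mul = has_bochner_integral_mult_right
  have "has_bochner_integral std_normal (\<lambda>x. a * x ^ 2 + b * x ^ 1 + - a) (a * 1 + b * 0 + - a)"
    by (intro add mul m m0)
  moreover have "p = (\<lambda>x. a * x ^ 2 + b * x ^ 1 + - a)" by (simp add: p_def fun_eq_iff algebra_simps)
  ultimately show "has_bochner_integral std_normal p 0" by simp
  \<comment> \<open>Coefficients of the square of \<open>p\<close>; keeping them symbolic makes the
    fourth power one squaring of a quartic.\<close>
  define B C D where "B = 2 * a * b" and "C = b\<^sup>2 - 2 * a\<^sup>2" and "D = - 2 * a * b"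
  have p2: "(p x)\<^sup>2 = a\<^sup>2 * x ^ 4 + B * x ^ 3 + C * x ^ 2 + D * x ^ 1 + a\<^sup>2" for x
    by (simp add: p_def B_def C_def D_def power4_eq_xxxx power3_eq_cube power2_eq_square algebra_simps)
  have "has_bochner_integral std_normal (\<lambda>x. (p x)\<^sup>2) (a\<^sup>2 * 3 + B * 0 + C * 1 + D * 0 + a\<^sup>2)"
    unfolding p2 by (intro add mul m m0)
  moreover have "a\<^sup>2 * 3 + B * 0 + C * 1 + D * 0 + a\<^sup>2 = 2 * a\<^sup>2 + b\<^sup>2" by (simp add: C_def)
  ultimately show "has_bochner_integral std_normal (\<lambda>x. (p x)\<^sup>2) (2 * a\<^sup>2 + b\<^sup>2)"
    by (simp only:)
  define A where "A = a\<^sup>2"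
  have p4: "p x ^ 4 = A\<^sup>2 * x ^ 8 + (2 * A * B) * x ^ 7 + (2 * A * C + B\<^sup>2) * x ^ 6
      + (2 * A * D + 2 * B * C) * x ^ 5 + (2 * A * A + 2 * B * D + C\<^sup>2) * x ^ 4
      + (2 * B * A + 2 * C * D) * x ^ 3 + (2 * C * A + D\<^sup>2) * x ^ 2 + (2 * D * A) * x ^ 1 + A\<^sup>2" for x
  proof -
    have "p x ^ 4 = ((p x)\<^sup>2)\<^sup>2" by simp
    also have "\<dots> = (A * x ^ 4 + B * x ^ 3 + C * x ^ 2 + D * x ^ 1 + A)\<^sup>2"
      unfolding p2 A_def ..
    also have "\<dots> = A\<^sup>2 * x ^ 8 + (2 * A * B) * x ^ 7 + (2 * A * C + B\<^sup>2) * x ^ 6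
      + (2 * A * D + 2 * B * C) * x ^ 5 + (2 * A * A + 2 * B * D + C\<^sup>2) * x ^ 4
      + (2 * B * A + 2 * C * D) * x ^ 3 + (2 * C * A + D\<^sup>2) * x ^ 2 + (2 * D * A) * x ^ 1 + A\<^sup>2"
      by (simp add: power2_eq_square eval_nat_numeral algebra_simps)
    finally show ?thesis .
  qed
  have "has_bochner_integral std_normal (\<lambda>x. p x ^ 4)
      (A\<^sup>2 * 105 + (2 * A * B) * 0 + (2 * A * C + B\<^sup>2) * 15
      + (2 * A * D + 2 * B * C) * 0 + (2 * A * A + 2 * B * D + C\<^sup>2) * 3
      + (2 * B * A + 2 * C * D) * 0 + (2 * C * A + D\<^sup>2) * 1 + (2 * D * A) * 0 + A\<^sup>2)"
    unfolding p4 by (intro add mul m m0)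
  moreover have "A\<^sup>2 * 105 + (2 * A * B) * 0 + (2 * A * C + B\<^sup>2) * 15
      + (2 * A * D + 2 * B * C) * 0 + (2 * A * A + 2 * B * D + C\<^sup>2) * 3
      + (2 * B * A + 2 * C * D) * 0 + (2 * C * A + D\<^sup>2) * 1 + (2 * D * A) * 0 + A\<^sup>2
    = 60 * a ^ 4 + 60 * a\<^sup>2 * b\<^sup>2 + 3 * b ^ 4"
    by (simp add: A_def B_def C_def D_def power4_eq_xxxx power2_eq_square algebra_simps)
  ultimately show "has_bochner_integral std_normal (\<lambda>x. p x ^ 4) (60 * a ^ 4 + 60 * a\<^sup>2 * b\<^sup>2 + 3 * b ^ 4)"
    by (simp only:)
qed

lemma std_gaussian_nth_integral:
  fixes f :: "real \<Rightarrow> real"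
  assumes "has_bochner_integral std_normal f c"
  shows "integrable (std_gaussian :: (real ^ 'n) measure) (\<lambda>x. f (x $ i))"
    and "(\<integral>x. f (x $ i) \<partial>(std_gaussian :: (real ^ 'n) measure)) = c"
proof -
  have f: "integrable (distr (std_gaussian :: (real ^ 'n) measure) borel (\<lambda>x. x $ i)) f"
    "integral\<^sup>L (distr (std_gaussian :: (real ^ 'n) measure) borel (\<lambda>x. x $ i)) f = c"
    using assms by (simp_all add: distr_std_gaussian_nth has_bochner_integral_iff)
  then have [measurable]: "f \<in> borel_measurable borel"
    by (auto dest: borel_measurable_integrable)
  show "integrable (std_gaussian :: (real ^ 'n) measure) (\<lambda>x. f (x $ i))"
    "(\<integral>x. f (x $ i) \<partial>(std_gaussian :: (real ^ 'n) measure)) = c"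
    using f by (simp_all add: integrable_distr_eq integral_distr)
qed

text \<open>The shift \<open>c\<close> is arbitrary: its contribution \<open>c\<^sup>2\<close> to
  the second moment is simply dropped. Integrability is assumed because it fails when some
  \<open>a i \<le> - 1 / 2\<close>; for a likelihood ratio it comes from the total mass.\<close>

lemma std_gaussian_quadratic_lower_bound:
  fixes a b :: "'n::finite \<Rightarrow> real" and c t :: real
  defines "h \<equiv> \<lambda>x. (\<Sum>i\<in>UNIV. a i * ((x $ i)\<^sup>2 - 1) + b i * x $ i) + c"
  assumes t: "0 < t" "t\<^sup>2 \<le> 4 / 25" "t\<^sup>2 \<le> (\<Sum>i\<in>UNIV. 2 * (a i)\<^sup>2 + (b i)\<^sup>2)"
    and int: "integrable std_gaussian (\<lambda>x. 1 - exp (- h x))"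
  shows "t / 20 \<le> (\<integral>x. \<bar>1 - exp (- h x)\<bar> \<partial>std_gaussian)"
proof -
  interpret G: prob_space "std_gaussian :: (real ^ 'n) measure" by (rule prob_space_std_gaussian)
  define Z where "Z i x = a i * ((x $ i)\<^sup>2 - 1) + b i * x $ i" for i and x :: "real ^ 'n"
  have [measurable]: "Z i \<in> borel_measurable borel" for i unfolding Z_def by measurable
  note q = std_normal_quadratic_moments[of "a i" "b i" for i]
  have Z1: "G.expectation (Z i) = 0" for i
    using std_gaussian_nth_integral(2)[OF q(1)[of i], of i] unfolding Z_def .
  have Z2: "G.expectation (\<lambda>x. (Z i x)\<^sup>2) = 2 * (a i)\<^sup>2 + (b i)\<^sup>2" for i
    using std_gaussian_nth_integral(2)[OF q(2)[of i], of i] unfolding Z_def .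
  have Z4: "integrable std_gaussian (\<lambda>x. Z i x ^ 4)"
    "G.expectation (\<lambda>x. Z i x ^ 4) = 60 * a i ^ 4 + 60 * (a i)\<^sup>2 * (b i)\<^sup>2 + 3 * b i ^ 4" for i
    using std_gaussian_nth_integral[OF q(3)[of i], of i] unfolding Z_def by auto
  have Z42: "G.expectation (\<lambda>x. Z i x ^ 4) \<le> 15 * (G.expectation (\<lambda>x. (Z i x)\<^sup>2))\<^sup>2" for i
  proof -
    have "15 * (2 * (a i)\<^sup>2 + (b i)\<^sup>2)\<^sup>2 = 60 * a i ^ 4 + 60 * (a i)\<^sup>2 * (b i)\<^sup>2 + 15 * b i ^ 4"
      by (simp add: power4_eq_xxxx power2_eq_square algebra_simps)
    moreover have "0 \<le> b i ^ 4" by simp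
    ultimately show ?thesis unfolding Z2 Z4(2) by linarith
  qed
  have ind: "G.indep_vars (\<lambda>_. borel) Z UNIV"
    unfolding Z_def using indep_vars_std_gaussian
    by (rule G.indep_vars_compose2[where Y="\<lambda>i u. a i * (u\<^sup>2 - 1) + b i * u"]) simp
  from G.fourth_moment_sum[OF finite ind Z4(1) Z1 Z42]
  have S: "integrable std_gaussian (\<lambda>x. (\<Sum>i\<in>UNIV. Z i x) ^ 4)"
    "G.expectation (\<lambda>x. \<Sum>i\<in>UNIV. Z i x) = 0"
    "G.expectation (\<lambda>x. (\<Sum>i\<in>UNIV. Z i x)\<^sup>2) = (\<Sum>i\<in>UNIV. 2 * (a i)\<^sup>2 + (b i)\<^sup>2)"
    "G.expectation (\<lambda>x. (\<Sum>i\<in>UNIV. Z i x) ^ 4) \<le> 15 * (G.expectation (\<lambda>x. (\<Sum>i\<in>UNIV. Z i x)\<^sup>2))\<^sup>2"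
    by (auto simp: Z2)
  note h = G.shifted_fourth_moment[OF _ S(1,2,4), of c]
  have hZ: "h = (\<lambda>x. (\<Sum>i\<in>UNIV. Z i x) + c)" by (simp add: h_def Z_def)
  show ?thesis
  proof (rule G.expectation_abs_one_minus_exp_ge[OF _ _ _ t(1,2) _ int])
    show "t\<^sup>2 \<le> G.expectation (\<lambda>x. (h x)\<^sup>2)"
      unfolding hZ using h(2) S(3) t(3) by (simp add: add_increasing2)
  qed (use h in \<open>auto simp: hZ\<close>)
qed

section \<open>Lower bound for the total variation distance\<close>

lemma abs_measure_diff_le_TV:
  assumes "prob_space P" "prob_space Q" "A \<in> sets borel"
  shows "\<bar>measure P A - measure Q A\<bar> \<le> TV P Q"
  unfolding TV_def
proof (rule cSUP_upper)
  interpret P: prob_space P by fact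
  interpret Q: prob_space Q by fact
  show "bdd_above ((\<lambda>A. \<bar>measure P A - measure Q A\<bar>) ` sets borel)"
  proof (rule bdd_aboveI2)
    fix A
    show "\<bar>measure P A - measure Q A\<bar> \<le> 1"
      using P.prob_le_1[of A] Q.prob_le_1[of A] measure_nonneg[of P A] measure_nonneg[of Q A] by linarith
  qed
qed fact

text \<open>Splitting at \<open>f \<le> 1\<close> removes the absolute value: the integral becomes
  the difference of the measures on that event plus the reverse difference on its complement, each
  at most \<open>TV P Q\<close>.\<close>

lemma two_TV_ge_expectation_density:
  fixes P Q :: "'a::topological_space measure" and f :: "'a \<Rightarrow> real"
  assumes P: "prob_space P" and Q: "prob_space Q" and sets [measurable_cong]: "sets Q = sets borel"
    and f [measurable]: "f \<in> borel_measurable borel" and nonneg: "\<And>x. 0 \<le> f x"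
    and PQ: "P = density Q (\<lambda>x. ennreal (f x))"
  shows "integrable Q f" and "(\<integral>x. \<bar>1 - f x\<bar> \<partial>Q) \<le> 2 * TV P Q"
proof -
  interpret P: prob_space P by fact
  interpret Q: prob_space Q by fact
  have "(\<integral>\<^sup>+x. ennreal (f x) \<partial>Q) = emeasure P (space P)"
    unfolding PQ by (subst emeasure_density) (auto intro!: nn_integral_cong)
  then have "(\<integral>\<^sup>+x. ennreal (f x) \<partial>Q) = 1" by (simp add: P.emeasure_space_1)
  then show int: "integrable Q f" using nonneg by (intro integrableI_nonneg) auto
  have meas: "measure P A = (\<integral>x. indicator A x * f x \<partial>Q)" "integrable Q (\<lambda>x. indicator A x * f x)"
    "measure Q A = (\<integral>x. indicator A x \<partial>Q)" "integrable Q (indicator A :: _ \<Rightarrow> real)"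
    if [measurable]: "A \<in> sets borel" for A
  proof -
    have A: "A \<in> sets Q" by (simp add: sets)
    show *: "integrable Q (\<lambda>x. indicator A x * f x)"
      using integrable_mult_indicator[OF A int] by simp
    have "emeasure P A = (\<integral>\<^sup>+x. ennreal (indicator A x * f x) \<partial>Q)"
      unfolding PQ using A by (subst emeasure_density) (auto intro!: nn_integral_cong split: split_indicator)
    also have "\<dots> = ennreal (\<integral>x. indicator A x * f x \<partial>Q)"
      using * nonneg by (intro nn_integral_eq_integral) auto
    finally show "measure P A = (\<integral>x. indicator A x * f x \<partial>Q)"
      using nonneg by (intro measure_eq_emeasure_eq_ennreal) auto
    show "measure Q A = (\<integral>x. indicator A x \<partial>Q)" "integrable Q (indicator A :: _ \<Rightarrow> real)"
      using A by (auto simp: Q.emeasure_eq_measure)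
  qed
  define A where "A = {x. f x \<le> 1}"
  have A [measurable]: "A \<in> sets borel" unfolding A_def by measurable
  have A' [measurable]: "- A \<in> sets borel" using A by (rule borel_comp)
  have "\<bar>1 - f x\<bar> = (indicator A x - indicator A x * f x) + (indicator (- A) x * f x - indicator (- A) x)" for x
    by (auto simp: A_def split: split_indicator)
  then have "(\<integral>x. \<bar>1 - f x\<bar> \<partial>Q) = (measure Q A - measure P A) + (measure P (- A) - measure Q (- A))"
    using meas[OF A] meas[OF A'] by simp
  also have "\<dots> \<le> TV P Q + TV P Q"
    using abs_measure_diff_le_TV[OF P Q A] abs_measure_diff_le_TV[OF P Q A'] by linarith
  finally show "(\<integral>x. \<bar>1 - f x\<bar> \<partial>Q) \<le> 2 * TV P Q" by simp
qed

text \<open>In the coordinates \<open>y\<close> with \<open>x = m2 + T (diagm (sqrt l)) y\<close>, the second Gaussian is standard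
  and minus the log-likelihood ratio is a quadratic polynomial without mixed terms.\<close>

lemma TV_gaussian_ge:
  fixes T R :: "real ^ 'n ^ 'n"
  assumes TR: "T ** R = mat 1" and l: "\<And>i. 0 < l i"
    and S1: "S1 = T ** transpose T" and S2: "S2 = T ** diagm l ** transpose T"
    and t: "0 < t" "t\<^sup>2 \<le> 4 / 25"
      "t\<^sup>2 \<le> (\<Sum>i\<in>UNIV. (l i - 1)\<^sup>2 / 2 + l i * ((R *v (m1 - m2)) $ i)\<^sup>2)"
  shows "t / 40 \<le> TV (gaussian m1 S1) (gaussian m2 S2)"
proof -
  define w where "w = R *v (m1 - m2)"
  define L where "L = diagm (\<lambda>i. sqrt (l i))"
  define L' where "L' = diagm (\<lambda>i. 1 / sqrt (l i))"
  have l0: "l i \<noteq> 0" for i using l[of i] by simp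
  have RT: "R ** T = mat 1" using TR matrix_left_right_inverse by blast
  have LL: "L ** L' = mat 1" "L' ** L = mat 1" by (simp_all add: L_def L'_def diagm_mult l0)
  define U where "U = T ** L"
  have "U ** (L' ** R) = T ** (L ** L') ** R" by (simp add: U_def matrix_mul_assoc)
  then have UV: "U ** (L' ** R) = mat 1" by (simp add: LL TR)
  have S2U: "S2 = U ** transpose U"
  proof -
    have "U ** transpose U = T ** (L ** L) ** transpose T"
      by (simp add: U_def L_def matrix_transpose_mul matrix_mul_assoc)
    also have "L ** L = diagm l" using l by (simp add: L_def diagm_mult less_imp_le)
    finally show ?thesis by (simp add: S2)
  qed
  have invT: "invertible T" and invU: "invertible U"
    using TR UV invertible_right_inverse by blast+
  define P where "P = gaussian m1 S1"
  define Q where "Q = gaussian m2 S2"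
  define G where "G = (std_gaussian :: (real ^ 'n) measure)"
  interpret G: prob_space G unfolding G_def by (rule prob_space_std_gaussian)
  have [measurable_cong]: "sets G = sets borel" "sets Q = sets borel" "sets P = sets borel"
    by (simp_all add: G_def Q_def P_def)
  have P: "prob_space P"
    unfolding P_def S1 gaussian_eq_distr_std_gaussian[OF invT] G_def[symmetric]
    by (rule G.prob_space_distr) measurable
  have QG: "Q = distr G borel (\<lambda>y. m2 + U *v y)"
    unfolding Q_def S2U G_def by (rule gaussian_eq_distr_std_gaussian[OF invU])
  have Q: "prob_space Q"
    unfolding QG by (rule G.prob_space_distr) measurable
  define p where "p = gaussian_density m1 S1"
  define q where "q = gaussian_density m2 S2"
  have [measurable]: "p \<in> borel_measurable borel" "q \<in> borel_measurable borel"
    by (simp_all add: p_def q_def)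
  define k where "k = (1 / sqrt (2 * pi)) ^ CARD('n)"
  have k: "0 < k" by (simp add: k_def)
  have dT: "0 < \<bar>det T\<bar>" "0 < \<bar>det U\<bar>" using invT invU by (simp_all add: invertible_det_nz)
  have p: "p x = k / \<bar>det T\<bar> * exp (- (norm (R *v (x - m1)))\<^sup>2 / 2)" for x
    unfolding p_def S1 gaussian_density_affine[OF TR] k_def ..
  have q: "q x = k / \<bar>det U\<bar> * exp (- (norm ((L' ** R) *v (x - m2)))\<^sup>2 / 2)" for x
    unfolding q_def S2U gaussian_density_affine[OF UV] k_def ..
  have pos: "0 < p x" "0 < q x" for x unfolding p q using k dT by simp_all
  define f where "f x = p x / q x" for x
  have [measurable]: "f \<in> borel_measurable borel" unfolding f_def by measurable
  have f0: "0 \<le> f x" for x unfolding f_def using pos by (simp add: less_imp_le)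
  have PQ: "P = density Q (\<lambda>x. ennreal (f x))"
  proof -
    have "ennreal (p x) = ennreal (q x) * ennreal (f x)" for x
      using pos(1)[of x] pos(2)[of x] by (subst ennreal_mult[symmetric]) (auto simp: f_def less_imp_le)
    then show ?thesis
      unfolding P_def Q_def gaussian_def p_def[symmetric] q_def[symmetric]
      by (subst density_density_eq) auto
  qed
  \<comment> \<open>Half the difference of the exponents,
    \<open>(norm (L *v y - w))\<^sup>2 - (norm y)\<^sup>2\<close>, expands coordinatewise with
    coefficients \<open>a i\<close> of the square and \<open>b i\<close> of the linear term.
    Centring the squares moves the sum of \<open>a\<close> into \<open>c\<close>, together with the
    ratio of determinants.\<close>
  define a where "a i = (l i - 1) / 2" for i
  define b where "b i = - (sqrt (l i) * w $ i)" for i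
  define c where "c = sum a UNIV + (norm w)\<^sup>2 / 2 - ln (\<bar>det U\<bar> / \<bar>det T\<bar>)"
  define h where "h = (\<lambda>y. (\<Sum>i\<in>UNIV. a i * ((y $ i)\<^sup>2 - 1) + b i * y $ i) + c)"
  have fh: "f (m2 + U *v y) = exp (- h y)" for y
  proof -
    have "R *v (m2 + U *v y - m1) = (R ** U) *v y - w"
      by (simp add: w_def algebra_simps matrix_vector_mul_assoc)
    also have "R ** U = L" by (simp add: U_def matrix_mul_assoc RT)
    finally have 1: "R *v (m2 + U *v y - m1) = L *v y - w" .
    have "(L' ** R) *v (m2 + U *v y - m2) = (L' ** (R ** T) ** L) *v y"
      by (simp add: U_def matrix_vector_mul_assoc matrix_mul_assoc)
    then have 2: "(L' ** R) *v (m2 + U *v y - m2) = y" by (simp add: RT LL)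
    have nv: "(norm x)\<^sup>2 = (\<Sum>i\<in>UNIV. (x $ i)\<^sup>2)" for x :: "real ^ 'n"
      unfolding power2_norm_eq_inner by (simp add: inner_vec_def power2_eq_square)
    have sq: "(sqrt (l i) * y $ i - w $ i)\<^sup>2 = l i * (y $ i)\<^sup>2 + 2 * b i * y $ i + (w $ i)\<^sup>2" for i
      using l[of i] by (simp add: power2_diff power_mult_distrib b_def less_imp_le)
    have hy: "(norm (L *v y - w))\<^sup>2 / 2 - (norm y)\<^sup>2 / 2 = h y + ln (\<bar>det U\<bar> / \<bar>det T\<bar>)"
    proof -
      have "(norm (L *v y - w))\<^sup>2 / 2 - (norm y)\<^sup>2 / 2
          = (\<Sum>i\<in>UNIV. (l i * (y $ i)\<^sup>2 + 2 * b i * y $ i + (w $ i)\<^sup>2) / 2 - (y $ i)\<^sup>2 / 2)"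
        unfolding nv by (simp add: L_def diagm_mult_vec sq sum_divide_distrib sum_subtractf)
      also have "\<dots> = (\<Sum>i\<in>UNIV. (a i * ((y $ i)\<^sup>2 - 1) + b i * y $ i) + a i + (w $ i)\<^sup>2 / 2)"
        by (intro sum.cong) (auto simp: a_def field_simps)
      also have "\<dots> = h y + ln (\<bar>det U\<bar> / \<bar>det T\<bar>)"
        by (simp add: h_def c_def nv sum.distrib sum_divide_distrib)
      finally show ?thesis .
    qed
    have "f (m2 + U *v y) = \<bar>det U\<bar> / \<bar>det T\<bar> * exp ((norm y)\<^sup>2 / 2 - (norm (L *v y - w))\<^sup>2 / 2)"
    proof -
      have A: "k / d * x / (k / d' * x') = d' / d * (x / x')" if "d \<noteq> 0" "d' \<noteq> 0" "x' \<noteq> 0" for d d' x x'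
        using k that by (simp add: field_simps)
      have E: "exp (- s / 2) / exp (- s' / 2) = exp (s' / 2 - s / 2)" for s s' :: real
        by (simp flip: exp_diff)
      show ?thesis unfolding f_def p q 1 2 E[symmetric] by (rule A) (use dT in auto)
    qed
    also have "\<dots> = exp (ln (\<bar>det U\<bar> / \<bar>det T\<bar>) + ((norm y)\<^sup>2 / 2 - (norm (L *v y - w))\<^sup>2 / 2))"
      using dT by (subst exp_add) simp
    also have "\<dots> = exp (- h y)" using hy by (intro arg_cong[where f=exp]) linarith
    finally show ?thesis .
  qed
  note TV = two_TV_ge_expectation_density[OF P Q \<open>sets Q = sets borel\<close> \<open>f \<in> borel_measurable borel\<close> f0 PQ]
  \<comment> \<open>Integrability of \<open>exp (- h)\<close> is read off from its being a
    probability density.\<close>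
  have "integrable G (\<lambda>y. f (m2 + U *v y))"
    using TV(1) unfolding QG by (subst (asm) integrable_distr_eq) auto
  then have int: "integrable std_gaussian (\<lambda>y. 1 - exp (- h y))"
    unfolding fh G_def using G.integrable_const[of 1] unfolding G_def by (intro Bochner_Integration.integrable_diff) auto
  have "(2::real) * (a i)\<^sup>2 + (b i)\<^sup>2 = (l i - 1)\<^sup>2 / 2 + l i * (w $ i)\<^sup>2" for i
    using l[of i] by (simp add: a_def b_def power_mult_distrib power_divide less_imp_le)
  then have "t\<^sup>2 \<le> (\<Sum>i\<in>UNIV. 2 * (a i)\<^sup>2 + (b i)\<^sup>2)" using t(3) unfolding w_def by simp
  from std_gaussian_quadratic_lower_bound[OF t(1,2) this int[unfolded h_def]]
  have "t / 20 \<le> (\<integral>y. \<bar>1 - exp (- h y)\<bar> \<partial>G)" unfolding G_def h_def .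
  also have "\<dots> = (\<integral>x. \<bar>1 - f x\<bar> \<partial>Q)"
    unfolding QG by (subst integral_distr) (auto simp: fh)
  also have "\<dots> \<le> 2 * TV P Q" by (rule TV(2))
  finally show ?thesis unfolding P_def Q_def by simp
qed

section \<open>Comparison of \<open>tv\<close> with the variance\<close>

text \<open>Each single weight is bounded by the Euclidean norm of all of them. With
  \<open>n i = l i - 1\<close> this controls the first quantity in \<open>tv\<close>.\<close>

lemma abs_weighted_sum_le:
  fixes n e :: "'n::finite \<Rightarrow> real"
  shows "\<bar>\<Sum>i\<in>UNIV. n i * (e i)\<^sup>2\<bar> \<le> sqrt (\<Sum>i\<in>UNIV. (n i)\<^sup>2) * (\<Sum>i\<in>UNIV. (e i)\<^sup>2)"
proof -
  have n: "\<bar>n i\<bar> \<le> sqrt (\<Sum>i\<in>UNIV. (n i)\<^sup>2)" for i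
    by (rule real_le_rsqrt) (auto intro: member_le_sum)
  have "\<bar>\<Sum>i\<in>UNIV. n i * (e i)\<^sup>2\<bar> \<le> (\<Sum>i\<in>UNIV. \<bar>n i * (e i)\<^sup>2\<bar>)" by (rule sum_abs)
  also have "\<dots> \<le> (\<Sum>i\<in>UNIV. sqrt (\<Sum>i\<in>UNIV. (n i)\<^sup>2) * (e i)\<^sup>2)"
    by (intro sum_mono) (auto simp: abs_mult intro: mult_right_mono n)
  finally show ?thesis by (simp add: sum_distrib_left)
qed

theorem theorem1p2:
  fixes \<mu>1 \<mu>2 :: "real ^ 'n"
    and \<Sigma>1 \<Sigma>2 :: "real ^ 'n ^ 'n"
    and B :: "real ^ 'm ^ 'n"
    and \<rho> :: "'m \<Rightarrow> real"
  assumes "CARD('n) > 1"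
    and "CARD('m) = CARD('n) - 1"
    and "\<mu>1 \<noteq> \<mu>2"
    and "pos_def_matrix \<Sigma>1"
    and "pos_def_matrix \<Sigma>2"
    and "columns_basis_of B {x. orthogonal (\<mu>1 - \<mu>2) x}"
    and "eigenvalue_family
           (matrix_inv (transpose B ** \<Sigma>1 ** B) ** (transpose B ** \<Sigma>2 ** B) - mat 1) \<rho>"
  shows "min 1 (tv \<mu>1 \<Sigma>1 \<mu>2 \<Sigma>2 \<rho>) / 200 \<le> TV (gaussian \<mu>1 \<Sigma>1) (gaussian \<mu>2 \<Sigma>2)"
proof -
  have "transpose \<Sigma>2 = \<Sigma>2" using assms(5) by (simp add: pos_def_matrix_def)
  with assms(4) obtain T :: "real ^ 'n ^ 'n" and l where T: "invertible T"
    and S1: "\<Sigma>1 = T ** transpose T" and S2: "\<Sigma>2 = T ** diagm l ** transpose T"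
    by (rule simultaneous_diagonalization)
  obtain R where TR: "T ** R = mat 1" "R ** T = mat 1" using T unfolding invertible_def by blast
  have quad1: "x \<bullet> (\<Sigma>1 *v x) = (\<Sum>i\<in>UNIV. ((transpose T *v x) $ i)\<^sup>2)" for x
  proof -
    have "x \<bullet> (\<Sigma>1 *v x) = (transpose T *v x) \<bullet> (transpose T *v x)"
      by (metis S1 inner_transpose_mult matrix_vector_mul_assoc transpose_transpose)
    then show ?thesis by (simp add: inner_vec_def power2_eq_square del: transpose_matrix_vector)
  qed
  have quad2: "x \<bullet> (\<Sigma>2 *v x) = (\<Sum>i\<in>UNIV. l i * ((transpose T *v x) $ i)\<^sup>2)" for x
  proof -
    have "x \<bullet> (\<Sigma>2 *v x) = (transpose T *v x) \<bullet> (diagm l *v (transpose T *v x))"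
      by (metis S2 inner_transpose_mult matrix_vector_mul_assoc transpose_transpose)
    then show ?thesis by (simp add: inner_vec_def diagm_mult_vec power2_eq_square mult_ac del: transpose_matrix_vector)
  qed
  have l: "0 < l i" for i
  proof -
    have e: "transpose T *v (transpose R *v axis i 1) = axis i 1"
      by (simp add: matrix_vector_mul_assoc TR flip: matrix_transpose_mul del: transpose_matrix_vector)
    then have "transpose R *v axis i 1 \<noteq> 0"
      by (metis axis_eq_0_iff matrix_vector_mult_0_right zero_neq_one)
    then have "0 < (\<Sum>j\<in>UNIV. l j * ((axis i 1 :: real ^ 'n) $ j)\<^sup>2)"
      using assms(5) quad2 e unfolding pos_def_matrix_def by metis
    then show ?thesis
      by (simp add: axis_def if_distrib[where f="\<lambda>x. x\<^sup>2"] if_distrib[where f="\<lambda>x. _ * x"] cong: if_cong)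
  qed
  define v where "v = \<mu>1 - \<mu>2"
  define w where "w = R *v v"
  define e where "e = transpose T *v v"
  define N where "N = (\<Sum>i\<in>UNIV. (l i - 1)\<^sup>2)"
  define W where "W = (\<Sum>i\<in>UNIV. (w $ i)\<^sup>2)"
  have v: "v \<noteq> 0" using assms(3) by (simp add: v_def)
  have s1: "v \<bullet> (\<Sigma>1 *v v) = (norm e)\<^sup>2"
    unfolding quad1 e_def[symmetric] power2_norm_eq_inner by (simp add: inner_vec_def power2_eq_square)
  have vpos: "0 < v \<bullet> (\<Sigma>1 *v v)" using assms(4) v by (simp add: pos_def_matrix_def)
  have W: "norm w = sqrt W"
    unfolding W_def norm_eq_sqrt_inner by (simp add: inner_vec_def power2_eq_square)
  have term1: "\<bar>v \<bullet> ((\<Sigma>1 - \<Sigma>2) *v v)\<bar> / (v \<bullet> (\<Sigma>1 *v v)) \<le> sqrt N"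
  proof -
    have "v \<bullet> ((\<Sigma>1 - \<Sigma>2) *v v) = - (\<Sum>i\<in>UNIV. (l i - 1) * (e $ i)\<^sup>2)"
      unfolding matrix_vector_mult_diff_rdistrib inner_diff_right quad1 quad2 e_def[symmetric]
      by (simp add: algebra_simps sum_subtractf)
    then have "\<bar>v \<bullet> ((\<Sigma>1 - \<Sigma>2) *v v)\<bar> \<le> sqrt N * (v \<bullet> (\<Sigma>1 *v v))"
      using abs_weighted_sum_le[of "\<lambda>i. l i - 1" "\<lambda>i. e $ i"] unfolding N_def quad1 e_def[symmetric] by simp
    then show ?thesis using vpos by (simp add: pos_divide_le_eq)
  qed
  have term2: "(v \<bullet> v) / sqrt (v \<bullet> (\<Sigma>1 *v v)) \<le> sqrt W"
  proof -
    have "T *v w = v" by (simp add: w_def matrix_vector_mul_assoc TR)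
    \<comment> \<open>The numerator pairs \<open>v\<close> transported by \<open>transpose T\<close>
      with \<open>v\<close> transported by the inverse of \<open>T\<close>; by Cauchy-Schwarz the
      norm of \<open>e\<close> cancels the denominator.\<close>
    then have "v \<bullet> v = e \<bullet> w"
      unfolding e_def using inner_transpose_mult[of w T v] by (metis inner_commute)
    also have "\<dots> \<le> norm e * norm w" by (rule norm_cauchy_schwarz)
    finally show ?thesis using vpos unfolding s1 W by (simp add: pos_divide_le_eq mult.commute)
  qed
  have term3: "sqrt (\<Sum>i\<in>UNIV. (\<rho> i)\<^sup>2) \<le> sqrt N"
    unfolding N_def real_sqrt_le_iff
    by (rule compressed_eigenvalues_sum_squares_le[OF T columns_basis_of_mult_nonzero[OF assms(6)] S1 S2 assms(7)])
  define r where "r = min 1 (tv \<mu>1 \<Sigma>1 \<mu>2 \<Sigma>2 \<rho>)"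
  have tv_le: "tv \<mu>1 \<Sigma>1 \<mu>2 \<Sigma>2 \<rho> \<le> sqrt (max N W)"
  proof -
    have m: "sqrt N \<le> sqrt (max N W)" "sqrt W \<le> sqrt (max N W)" by simp_all
    note order_trans[OF term1 m(1)] order_trans[OF term2 m(2)] order_trans[OF term3 m(1)]
    then show ?thesis unfolding tv_def Let_def v_def[symmetric]
      by (intro Max.boundedI) (auto simp del: real_sqrt_le_iff)
  qed
  \<comment> \<open>Distinct means make \<open>tv\<close> strictly positive, as the lower bound on
    \<open>TV\<close> is stated for \<open>0 < t\<close>.\<close>
  have "0 < (v \<bullet> v) / sqrt (v \<bullet> (\<Sigma>1 *v v))" using v vpos by simp
  also have "\<dots> \<le> tv \<mu>1 \<Sigma>1 \<mu>2 \<Sigma>2 \<rho>" unfolding tv_def Let_def v_def[symmetric] by (intro Max_ge) auto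
  finally have r0: "0 < r" by (simp add: r_def)
  have r1: "r\<^sup>2 \<le> 1" using r0 by (simp add: r_def power_le_one)
  have r2: "r\<^sup>2 \<le> max N W"
  proof -
    have "0 \<le> max N W" unfolding N_def by (auto intro: sum_nonneg simp: le_max_iff_disj)
    moreover have "r \<le> sqrt (max N W)" using tv_le by (simp add: r_def)
    then have "r\<^sup>2 \<le> (sqrt (max N W))\<^sup>2" using r0 by (intro power_mono) auto
    ultimately show ?thesis by simp
  qed
  have V: "r\<^sup>2 / 8 \<le> (\<Sum>i\<in>UNIV. (l i - 1)\<^sup>2 / 2 + l i * (w $ i)\<^sup>2)"
  \<comment> \<open>Above the threshold 1/2 both \<open>N / 2\<close> and \<open>W / 2\<close> are
    below the variance. Below it, a single coordinate contributes at least
    \<open>(1 / 2)\<^sup>2 / 2 = 1 / 8\<close>, which suffices as \<open>r \<le> 1\<close>.\<close>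
  proof (cases "\<forall>i. 1 / 2 \<le> l i")
    case True
    have "N / 2 \<le> (\<Sum>i\<in>UNIV. (l i - 1)\<^sup>2 / 2 + l i * (w $ i)\<^sup>2)"
      unfolding N_def sum_divide_distrib using l by (intro sum_mono) (simp add: less_imp_le)
    moreover have "W / 2 \<le> (\<Sum>i\<in>UNIV. (l i - 1)\<^sup>2 / 2 + l i * (w $ i)\<^sup>2)"
      unfolding W_def sum_divide_distrib
    proof (rule sum_mono)
      fix i
      have "1 / 2 * (w $ i)\<^sup>2 \<le> l i * (w $ i)\<^sup>2" using True by (intro mult_right_mono) auto
      moreover have "0 \<le> (l i - 1)\<^sup>2 / 2" by simp
      ultimately show "(w $ i)\<^sup>2 / 2 \<le> (l i - 1)\<^sup>2 / 2 + l i * (w $ i)\<^sup>2" by linarith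
    qed
    ultimately show ?thesis using r2 zero_le_power2[of r] by linarith
  next
    case False
    then obtain i where i: "l i < 1 / 2" by (auto simp: not_le)
    have "(1 / 2)\<^sup>2 \<le> (1 - l i)\<^sup>2" using i by (intro power_mono) auto
    then have "1 / 8 \<le> (l i - 1)\<^sup>2 / 2" by (simp add: power2_commute power_divide)
    also have "\<dots> \<le> (l i - 1)\<^sup>2 / 2 + l i * (w $ i)\<^sup>2" using l[of i] by (simp add: less_imp_le)
    also have "\<dots> \<le> (\<Sum>i\<in>UNIV. (l i - 1)\<^sup>2 / 2 + l i * (w $ i)\<^sup>2)"
      using l by (intro member_le_sum[where f="\<lambda>i. (l i - 1)\<^sup>2 / 2 + l i * (w $ i)\<^sup>2"])
        (auto simp: less_imp_le)
    finally show ?thesis using r1 by linarith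
  qed
  \<comment> \<open>Chosen so that \<open>t\<^sup>2\<close> is exactly the lower bound
    \<open>V\<close> for the variance; since \<open>r \<le> 1\<close>, it is at most 1/8, below the
    cap 4/25.\<close>
  define t where "t = r / sqrt 8"
  have t2: "t\<^sup>2 = r\<^sup>2 / 8" by (simp add: t_def power_divide)
  have "t / 40 \<le> TV (gaussian \<mu>1 \<Sigma>1) (gaussian \<mu>2 \<Sigma>2)"
  proof (rule TV_gaussian_ge[OF TR(1) l S1 S2])
    show "0 < t" using r0 by (simp add: t_def)
    show "t\<^sup>2 \<le> 4 / 25" unfolding t2 using r1 by simp
    show "t\<^sup>2 \<le> (\<Sum>i\<in>UNIV. (l i - 1)\<^sup>2 / 2 + l i * ((R *v (\<mu>1 - \<mu>2)) $ i)\<^sup>2)"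
      using V unfolding t2 w_def v_def .
  qed
  moreover have "r / 200 \<le> t / 40"
  proof -
    have "sqrt 8 \<le> 5" by (rule real_le_lsqrt) auto
    then have "r / 5 \<le> t" unfolding t_def using r0 by (intro divide_left_mono) auto
    then show ?thesis by simp
  qed
  ultimately show ?thesis unfolding r_def by linarith
qed

end
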